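(* Let $M_0\subset\mathbb{R}^{n+1}$ be a closed smooth mean convex hypersurface bounding a compact domain $\Omega_0$, let $u:\Omega_0\to\mathbb{R}$ be the arrival time of the mean curvature flow (level set flow) $M_t=\{u=t\}$ starting at $M_0$. If $u$ is real analytic on $\Omega_0$, then the flow $M_t$ has only finitely many singular times.
   Context: A closed hypersurface is compact without boundary and embedded; mean convex means positive mean curvature $H>0$ with respect to the outward unit normal of $\Omega_0$ (so the flow moves inward). Arrival time: $u$ is the unique continuous function on $\Omega_0$ with $u=0$ on $M_0=\partial\Omega_0$ that is a viscosity solution in the interior of $\Omega_0$ of $-1=|\nabla u|\,\mathrm{div}(\nabla u/|\nabla u|)=\Delta u-\mathrm{Hess}_u\left(\frac{\nabla u}{|\nabla u|},\frac{\nabla u}{|\nabla u|}\right)$. The (level set) mean curvature flow is $M_t=\{u=t\}$. Viscosity solution: a continuous $u$ is a sub solution if whenever $\phi$ is smooth and $u-\phi$ has a local maximum at $x_0$, then $\Delta\phi-\mathrm{Hess}_\phi\left(\frac{\nabla\phi}{|\nabla\phi|},\frac{\nabla\phi}{|\nabla\phi|}\right)\ge -1$ at $x_0$ if $\nabla\phi(x_0)\ne0$, and $\Delta\phi-\mathrm{Hess}_\phi(v,v)\ge -1$ at $x_0$ for some vector $|v|\le 1$ if $\nabla\phi(x_0)=0$. Super solutions are defined similarly (local minimum in place of local maximum, $\le$ in place of $\ge$). A viscosity solution is both a sub and a super solution. Singular points and times: a point $x\in\Omega_0$ is regular for the flow if, in some neighborhood of $x$ and for all times $s\ge 0$ in some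 interval around $u(x)$, the sets $M_s$ form a smooth family of smooth embedded hypersurfaces moving by mean curvature; otherwise $x$ is singular. A time $t$ is singular if $M_t$ contains a singular point. *)

theory Defs
  imports "HOL-Analysis.Analysis"
begin

text \<open>
  The ambient space \<open>\<real>\<^sup>n\<^sup>+\<^sup>1\<close> is an arbitrary Euclidean space \<open>'a\<close> with \<open>DIM('a) = n + 1\<close>.
  Functions such as the arrival time are total in HOL; nothing below depends on their values
  outside the set on which they are considered.
\<close>

section \<open>Differential calculus on open sets\<close>

primrec Ck_on :: "nat \<Rightarrow> 'a::euclidean_space set \<Rightarrow> ('a \<Rightarrow> 'b::real_normed_vector) \<Rightarrow> bool" where
  "Ck_on 0 U f \<longleftrightarrow> continuous_on U f"
| "Ck_on (Suc k) U f \<longleftrightarrow>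
     (\<forall>x\<in>U. f differentiable (at x)) \<and> (\<forall>v. Ck_on k U (\<lambda>x. frechet_derivative f (at x) v))"

text \<open>Only meaningful for open \<open>U\<close>.\<close>
definition smooth_on :: "'a::euclidean_space set \<Rightarrow> ('a \<Rightarrow> 'b::real_normed_vector) \<Rightarrow> bool" where
  "smooth_on U f \<longleftrightarrow> (\<forall>k. Ck_on k U f)"

definition grad :: "('a::euclidean_space \<Rightarrow> real) \<Rightarrow> 'a \<Rightarrow> 'a" where
  "grad f x = (\<Sum>b\<in>Basis. frechet_derivative f (at x) b *\<^sub>R b)"

definition Hess :: "('a::euclidean_space \<Rightarrow> real) \<Rightarrow> 'a \<Rightarrow> 'a \<Rightarrow> 'a \<Rightarrow> real" where
  "Hess f x v w = frechet_derivative (\<lambda>y. frechet_derivative f (at y) v) (at x) w"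

definition laplacian :: "('a::euclidean_space \<Rightarrow> real) \<Rightarrow> 'a \<Rightarrow> real" where
  "laplacian f x = (\<Sum>b\<in>Basis. Hess f x b b)"

definition unit_grad :: "('a::euclidean_space \<Rightarrow> real) \<Rightarrow> 'a \<Rightarrow> 'a" where
  "unit_grad f x = grad f x /\<^sub>R norm (grad f x)"

text \<open>
  Real analyticity on a set that need not be open (here: a compact domain): near every point of
  the set, boundary points included, the function agrees on the set with the sum of a power
  series that converges on a full ball.  The multi-indices are the \<open>\<alpha> :: 'a \<Rightarrow> nat\<close> that vanish
  off the coordinate basis; unconditional summation is absolute convergence.
\<close>
definition real_analytic_on :: "'a::euclidean_space set \<Rightarrow> ('a \<Rightarrow> real) \<Rightarrow> bool" where
  "real_analytic_on S f \<longleftrightarrow>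
     (\<forall>a\<in>S. \<exists>r>0. \<exists>(c :: ('a \<Rightarrow> nat) \<Rightarrow> real) g.
        (\<forall>x\<in>ball a r.
           ((\<lambda>\<alpha>. c \<alpha> * (\<Prod>b\<in>Basis. ((x - a) \<bullet> b) ^ \<alpha> b)) has_sum g x)
             {\<alpha>. \<forall>b. b \<notin> Basis \<longrightarrow> \<alpha> b = 0}) \<and>
        (\<forall>x\<in>S \<inter> ball a r. f x = g x))"

section \<open>Hypersurfaces and mean curvature\<close>

definition smooth_hypersurface :: "'a::euclidean_space set \<Rightarrow> bool" where
  "smooth_hypersurface M \<longleftrightarrow>
     (\<forall>p\<in>M. \<exists>U \<phi>. open U \<and> p \<in> U \<and> smooth_on U (\<phi> :: 'a \<Rightarrow> real) \<and>
        (\<forall>y\<in>U. grad \<phi> y \<noteq> 0) \<and> M \<inter> U = {y\<in>U. \<phi> y = 0})"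

text \<open>
  Being locally a regular level set in the ambient space, such a set is embedded and has no
  boundary.
\<close>
definition closed_smooth_hypersurface :: "'a::euclidean_space set \<Rightarrow> bool" where
  "closed_smooth_hypersurface M \<longleftrightarrow> compact M \<and> M \<noteq> {} \<and> smooth_hypersurface M"

definition bounds_compact_domain :: "'a::euclidean_space set \<Rightarrow> 'a set \<Rightarrow> bool" where
  "bounds_compact_domain M \<Omega> \<longleftrightarrow>
     compact \<Omega> \<and> \<Omega> \<noteq> {} \<and> connected (interior \<Omega>) \<and> \<Omega> = closure (interior \<Omega>) \<and> M = frontier \<Omega>"

text \<open>
  The trace of the shape operator \<open>v \<mapsto> D\<^sub>v N\<close> over the tangent space \<open>N(x)\<^sup>\<bottom>\<close>, for a unit normal
  field \<open>N\<close> extended smoothly to a neighbourhood of \<open>x\<close>: the full trace minus the normal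
  direction.  The value does not depend on the extension.  With the outward normal, a round
  sphere of radius \<open>r\<close> in \<open>\<real>\<^sup>n\<^sup>+\<^sup>1\<close> has mean curvature \<open>n / r\<close>.
\<close>
definition mean_curvature :: "('a::euclidean_space \<Rightarrow> 'a) \<Rightarrow> 'a \<Rightarrow> real" where
  "mean_curvature N x =
     (\<Sum>b\<in>Basis. frechet_derivative N (at x) b \<bullet> b) - frechet_derivative N (at x) (N x) \<bullet> N x"

text \<open>
  Since \<open>\<Omega>\<close> is locally \<open>{\<phi> \<le> 0}\<close>, the normal \<open>unit_grad \<phi>\<close> of its boundary points out of \<open>\<Omega>\<close>.
\<close>
definition has_outward_mean_curvature :: "'a::euclidean_space set \<Rightarrow> 'a \<Rightarrow> real \<Rightarrow> bool" where
  "has_outward_mean_curvature \<Omega> p H \<longleftrightarrow>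
     (\<exists>U \<phi>. open U \<and> p \<in> U \<and> smooth_on U \<phi> \<and> (\<forall>y\<in>U. grad \<phi> y \<noteq> 0) \<and>
        \<Omega> \<inter> U = {y\<in>U. \<phi> y \<le> 0} \<and> H = mean_curvature (unit_grad \<phi>) p)"

definition mean_convex_boundary :: "'a::euclidean_space set \<Rightarrow> bool" where
  "mean_convex_boundary \<Omega> \<longleftrightarrow> (\<forall>p\<in>frontier \<Omega>. \<exists>H>0. has_outward_mean_curvature \<Omega> p H)"

section \<open>The arrival time\<close>

definition viscosity_subsolution :: "'a::euclidean_space set \<Rightarrow> ('a \<Rightarrow> real) \<Rightarrow> bool" where
  "viscosity_subsolution U u \<longleftrightarrow> continuous_on U u \<and>
     (\<forall>\<phi> x0. x0 \<in> U \<and> smooth_on U \<phi> \<and> (\<forall>\<^sub>F x in nhds x0. u x - \<phi> x \<le> u x0 - \<phi> x0) \<longrightarrow>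
        (if grad \<phi> x0 \<noteq> 0
         then laplacian \<phi> x0 - Hess \<phi> x0 (unit_grad \<phi> x0) (unit_grad \<phi> x0) \<ge> -1
         else \<exists>v. norm v \<le> 1 \<and> laplacian \<phi> x0 - Hess \<phi> x0 v v \<ge> -1))"

definition viscosity_supersolution :: "'a::euclidean_space set \<Rightarrow> ('a \<Rightarrow> real) \<Rightarrow> bool" where
  "viscosity_supersolution U u \<longleftrightarrow> continuous_on U u \<and>
     (\<forall>\<phi> x0. x0 \<in> U \<and> smooth_on U \<phi> \<and> (\<forall>\<^sub>F x in nhds x0. u x - \<phi> x \<ge> u x0 - \<phi> x0) \<longrightarrow>
        (if grad \<phi> x0 \<noteq> 0
         then laplacian \<phi> x0 - Hess \<phi> x0 (unit_grad \<phi> x0) (unit_grad \<phi> x0) \<le> -1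
         else \<exists>v. norm v \<le> 1 \<and> laplacian \<phi> x0 - Hess \<phi> x0 v v \<le> -1))"

definition viscosity_solution :: "'a::euclidean_space set \<Rightarrow> ('a \<Rightarrow> real) \<Rightarrow> bool" where
  "viscosity_solution U u \<longleftrightarrow> viscosity_subsolution U u \<and> viscosity_supersolution U u"

text \<open>
  A predicate rather than a function of \<open>\<Omega>\<close>; by the comparison principle it determines \<open>u\<close> on \<open>\<Omega>\<close>.
\<close>
definition is_arrival_time :: "'a::euclidean_space set \<Rightarrow> ('a \<Rightarrow> real) \<Rightarrow> bool" where
  "is_arrival_time \<Omega> u \<longleftrightarrow>
     continuous_on \<Omega> u \<and> (\<forall>x\<in>frontier \<Omega>. u x = 0) \<and> viscosity_solution (interior \<Omega>) u"

section \<open>The flow and its singular times\<close>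

definition level_set_flow :: "'a::euclidean_space set \<Rightarrow> ('a \<Rightarrow> real) \<Rightarrow> real \<Rightarrow> 'a set" where
  "level_set_flow \<Omega> u t = {x\<in>\<Omega>. u x = t}"

text \<open>
  In the open set \<open>U\<close>, the sets \<open>M s\<close> with \<open>s \<in> I\<close> and \<open>s \<ge> 0\<close> form a smooth family of smooth
  embedded hypersurfaces (regular level sets of a function smooth in space and time) moving by
  mean curvature.  Differentiating \<open>\<Phi> (\<gamma> s, s) = 0\<close> along curves with \<open>\<gamma> s \<in> M s\<close> shows that the
  family has velocity \<open>- \<partial>\<^sub>s \<Phi> / \<bar>\<nabla>\<Phi>\<bar>\<close> in the direction of the unit normal \<open>\<nabla>\<Phi> / \<bar>\<nabla>\<Phi>\<bar>\<close>; under mean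
  curvature flow this is minus the mean curvature with respect to that normal.  As \<open>\<Phi>\<close> is smooth
  on an open time interval, the family is smooth up to \<open>s = 0\<close> when \<open>0 \<in> I\<close>.
\<close>
definition smooth_mcf_in :: "(real \<Rightarrow> 'a::euclidean_space set) \<Rightarrow> 'a set \<Rightarrow> real set \<Rightarrow> bool" where
  "smooth_mcf_in M U I \<longleftrightarrow>
     (\<exists>\<Phi> :: 'a \<times> real \<Rightarrow> real. smooth_on (U \<times> I) \<Phi> \<and>
        (\<forall>s\<in>I. s \<ge> 0 \<longrightarrow>
           M s \<inter> U = {y\<in>U. \<Phi> (y, s) = 0} \<and>
           (\<forall>y\<in>M s \<inter> U.
              grad (\<lambda>z. \<Phi> (z, s)) y \<noteq> 0 \<and>
              - deriv (\<lambda>r. \<Phi> (y, r)) s / norm (grad (\<lambda>z. \<Phi> (z, s)) y)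
                = - mean_curvature (unit_grad (\<lambda>z. \<Phi> (z, s))) y)))"

definition regular_point :: "'a::euclidean_space set \<Rightarrow> ('a \<Rightarrow> real) \<Rightarrow> 'a \<Rightarrow> bool" where
  "regular_point \<Omega> u x \<longleftrightarrow> x \<in> \<Omega> \<and>
     (\<exists>U \<delta>. open U \<and> x \<in> U \<and> \<delta> > 0 \<and>
        smooth_mcf_in (level_set_flow \<Omega> u) U {u x - \<delta> <..< u x + \<delta>})"

definition singular_point :: "'a::euclidean_space set \<Rightarrow> ('a \<Rightarrow> real) \<Rightarrow> 'a \<Rightarrow> bool" where
  "singular_point \<Omega> u x \<longleftrightarrow> x \<in> \<Omega> \<and> \<not> regular_point \<Omega> u x"

definition singular_time :: "'a::euclidean_space set \<Rightarrow> ('a \<Rightarrow> real) \<Rightarrow> real \<Rightarrow> bool" where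
  "singular_time \<Omega> u t \<longleftrightarrow> (\<exists>x\<in>level_set_flow \<Omega> u t. singular_point \<Omega> u x)"

end

theory Submission
  imports Defs
begin

text \<open>
  Only a critical point of the arrival time \<open>u\<close> or a boundary point can be singular: where
  \<open>\<nabla>u \<noteq> 0\<close> in the interior, \<open>u\<close> may be used as a test function against itself, so it solves the
  equation classically there, and the level sets of \<open>u (y) - s\<close> move by mean curvature
  (\<open>regular_point_interior\<close>).  Boundary points only contribute the time \<open>0\<close>.  It therefore suffices
  that \<open>u\<close> takes finitely many values on its interior critical points, and by compactness this is a
  local question at each point \<open>p\<close> of \<open>\<Omega>\<close>.

  The equation, written as \<open>\<bar>\<nabla>u\<bar>\<^sup>2 (\<Delta>u + 1) = Hess\<^sub>u(\<nabla>u, \<nabla>u)\<close>, is very rigid at a critical point.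
  Let \<open>A\<close> be the Hessian at \<open>p\<close>.  Inserting \<open>\<nabla>u (p + s e) = s A e + o(s)\<close> and comparing the terms of
  order \<open>s\<^sup>2\<close> shows \<open>A\<^sup>2 = \<kappa> A\<close> with \<open>\<kappa> = tr A + 1\<close>: the operator \<open>A\<close> is \<open>\<kappa>\<close> times an orthogonal
  projection (\<open>Hess_op_square\<close>).  The viscosity inequality excludes \<open>A = 0\<close>, and then the trace
  identity forces \<open>\<kappa> < 0\<close> (\<open>laplacian_less\<close>).

  Split the space as \<open>W \<oplus> K\<close>, the range and the kernel of \<open>A\<close>.  Near \<open>p\<close> the function \<open>u\<close> is
  uniformly concave along \<open>W\<close>, so it has a local maximiser close to \<open>p\<close> on each slice \<open>p + t + W\<close>
  with \<open>t\<close> small in \<open>K\<close>.  There \<open>\<nabla>u\<close> lies in \<open>K\<close>; if it were not zero, the equation would give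
  \<open>\<Delta>u + 1 = Hess\<^sub>u(\<nu>, \<nu>)\<close> with \<open>\<nu> = \<nabla>u / \<bar>\<nabla>u\<bar>\<close> in \<open>K\<close>, where the left side is close to \<open>\<kappa> < 0\<close> and the
  right side close to \<open>0\<close>.  So all slice maximisers are critical points, and the maximal value changes
  by at most \<open>O(\<bar>t - t'\<bar>\<^sup>2)\<close> between two slices; it is therefore constant.  Conversely, by concavity a
  critical point near \<open>p\<close> maximises \<open>u\<close> on its slice.  Hence \<open>u\<close> equals \<open>u (p)\<close> at all critical
  points near \<open>p\<close> (\<open>critical_value_locally_constant\<close>).

  A boundary point \<open>p\<close> is not a limit of interior critical points
  (\<open>no_critical_points_near_boundary\<close>).  By analyticity \<open>u\<close> extends across the boundary near \<open>p\<close>, and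
  the relations \<open>\<nabla>u = 0\<close>, \<open>A\<^sup>2 = \<kappa> A\<close>, \<open>tr A = \<kappa> - 1\<close>, \<open>\<kappa> \<le> 0\<close> would pass to the limit \<open>p\<close>.  Since \<open>u\<close>
  vanishes on the smooth hypersurface \<open>\<partial>\<Omega>\<close>, \<open>\<langle>A \<tau>, \<tau>\<rangle> = 0\<close> for tangent vectors \<open>\<tau>\<close>, hence
  \<open>\<bar>A \<tau>\<bar>\<^sup>2 = \<kappa> \<langle>A \<tau>, \<tau>\<rangle> = 0\<close>; so \<open>A\<close> has rank at most one and \<open>tr A\<close> is an eigenvalue of \<open>A\<close>, that is \<open>\<kappa> - 1 \<in> {0, \<kappa>}\<close>, contradicting
  \<open>\<kappa> \<le> 0\<close>.
\<close>

section \<open>Differentiating power series term by term\<close>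

lemma has_sum_sum:
  fixes f :: "'b \<Rightarrow> 'i \<Rightarrow> real"
  assumes "\<And>b. b \<in> B \<Longrightarrow> (f b has_sum s b) I"
  shows "((\<lambda>i. \<Sum>b\<in>B. f b i) has_sum (\<Sum>b\<in>B. s b)) I"
  using assms by (induction B rule: infinite_finite_induct) (auto intro!: has_sum_add)

text \<open>
  The derivatives are dominated by a summable family, so the terms outside a large finite set are
  jointly Lipschitz with a small constant; the finitely many remaining terms are differentiable.
\<close>
lemma has_derivative_has_sum:
  fixes f :: "'i \<Rightarrow> 'a::euclidean_space \<Rightarrow> real"
  assumes S: "convex S" "open S" "x \<in> S"
    and der: "\<And>i y. i \<in> I \<Longrightarrow> y \<in> S \<Longrightarrow> (f i has_derivative f' i y) (at y)"
    and bound: "\<And>i y h. i \<in> I \<Longrightarrow> y \<in> S \<Longrightarrow> \<bar>f' i y h\<bar> \<le> M i * norm h"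
    and M: "M summable_on I"
    and F: "\<And>y. y \<in> S \<Longrightarrow> ((\<lambda>i. f i y) has_sum F y) I"
    and F': "\<And>h. ((\<lambda>i. f' i x h) has_sum F' h) I" and lin: "bounded_linear F'"
  shows "(F has_derivative F') (at x)"
  unfolding has_derivative_at_alt
proof (intro conjI lin allI impI)
  fix e :: real assume e: "e > 0"
  from M obtain m where m: "(M has_sum m) I" by (auto simp: summable_on_def)
  then have "\<forall>\<^sub>F X in finite_subsets_at_top I. dist (sum M X) m < e/4"
    using m[unfolded has_sum_def tendsto_iff, rule_format, of "e/4"] e by simp
  then obtain X where X: "finite X" "X \<subseteq> I" "dist (sum M X) m < e/4"
    unfolding eventually_finite_subsets_at_top by blast
  have tailM: "(M has_sum (m - sum M X)) (I - X)"
    using has_sum_Diff[OF m has_sum_finite[OF X(1)] X(2)] .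
  have "((\<lambda>y. \<Sum>i\<in>X. f i y) has_derivative (\<lambda>h. \<Sum>i\<in>X. f' i x h)) (at x)"
    using X der S(3) by (intro has_derivative_sum) auto
  then obtain d where d: "d > 0" "\<And>y. norm (y - x) < d \<Longrightarrow>
      norm ((\<Sum>i\<in>X. f i y) - (\<Sum>i\<in>X. f i x) - (\<Sum>i\<in>X. f' i x (y - x))) \<le> (e/2) * norm (y - x)"
    unfolding has_derivative_at_alt using e by (meson half_gt_zero)
  obtain d' where d': "d' > 0" "ball x d' \<subseteq> S" using S openE by blast
  show "\<exists>d>0. \<forall>y. norm (y - x) < d \<longrightarrow> norm (F y - F x - F' (y - x)) \<le> e * norm (y - x)"
  proof (intro exI conjI allI impI)
    show "min d d' > 0" using d d' by simp
    fix y assume y: "norm (y - x) < min d d'"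
    then have yS: "y \<in> S" using d' by (auto simp: dist_norm norm_minus_commute subset_iff)
    define R where "R i = f i y - f i x - f' i x (y - x)" for i
    have R: "(R has_sum (F y - F x - F' (y - x))) I"
      unfolding R_def diff_conv_add_uminus by (intro has_sum_add has_sum_uminusI F F' yS S)
    have tail: "(R has_sum (F y - F x - F' (y - x) - sum R X)) (I - X)"
      using has_sum_Diff[OF R has_sum_finite[OF X(1)] X(2)] .
    have Rb: "norm (R i) \<le> M i * (2 * norm (y - x))" if "i \<in> I" for i
    proof -
      have "norm (f i y - f i x) \<le> M i * norm (y - x)"
      proof (rule differentiable_bound[OF S(1)])
        show "(f i has_derivative f' i z) (at z within S)" if "z \<in> S" for z
          using der[OF \<open>i \<in> I\<close> that] by (rule has_derivative_at_withinI)
        show "onorm (f' i z) \<le> M i" if "z \<in> S" for z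
          using bound[OF \<open>i \<in> I\<close> that] by (intro onorm_le) simp
      qed (use yS S in auto)
      with bound[OF that S(3), of "y - x"] show ?thesis unfolding R_def by simp
    qed
    have "norm (F y - F x - F' (y - x) - sum R X) \<le> (m - sum M X) * (2 * norm (y - x))"
      using has_sum_mono[OF tail has_sum_cmult_left[OF tailM, of "2 * norm (y - x)"]]
        has_sum_mono[OF has_sum_uminusI[OF tail] has_sum_cmult_left[OF tailM, of "2 * norm (y - x)"]] Rb
      by (fastforce simp: abs_le_iff)
    also have "\<dots> \<le> e/4 * (2 * norm (y - x))"
      using X(3)[unfolded dist_real_def] by (intro mult_right_mono) (linarith, simp)
    finally have 1: "norm (F y - F x - F' (y - x) - sum R X) \<le> e/2 * norm (y - x)" by simp
    have "norm (sum R X) \<le> e/2 * norm (y - x)"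
      using d(2)[of y] y unfolding R_def by (simp add: sum_subtractf)
    with 1 show "norm (F y - F x - F' (y - x)) \<le> e * norm (y - x)"
      by (smt (verit) real_norm_def field_sum_of_halves mult.commute ring_class.ring_distribs(1))
  qed
qed

definition multi_indices :: "('a::euclidean_space \<Rightarrow> nat) set" where
  "multi_indices = {\<alpha>. \<forall>b. b \<notin> Basis \<longrightarrow> \<alpha> b = 0}"

definition monomial :: "('a::euclidean_space \<Rightarrow> nat) \<Rightarrow> 'a \<Rightarrow> real" where
  "monomial \<alpha> z = (\<Prod>b\<in>Basis. (z \<bullet> b) ^ \<alpha> b)"

definition has_power_series :: "'a::euclidean_space \<Rightarrow> real \<Rightarrow> (('a \<Rightarrow> nat) \<Rightarrow> real) \<Rightarrow> ('a \<Rightarrow> real) \<Rightarrow> bool" where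
  "has_power_series a r c g \<longleftrightarrow>
     (\<forall>x\<in>ball a r. ((\<lambda>\<alpha>. c \<alpha> * monomial \<alpha> (x - a)) has_sum g x) multi_indices)"

text \<open>
  The coefficients of the partial derivative of the power series in the direction of the basis
  vector \<open>b\<close>; those of the derivative in an arbitrary direction are \<open>dir_coeff\<close> below.
\<close>
definition coeff_shift :: "'a \<Rightarrow> (('a \<Rightarrow> nat) \<Rightarrow> real) \<Rightarrow> ('a \<Rightarrow> nat) \<Rightarrow> real" where
  "coeff_shift b c \<alpha> = real (Suc (\<alpha> b)) * c (\<alpha>(b := Suc (\<alpha> b)))"

definition monomial_deriv :: "'a::euclidean_space \<Rightarrow> ('a \<Rightarrow> nat) \<Rightarrow> 'a \<Rightarrow> real" where
  "monomial_deriv b \<alpha> z = real (\<alpha> b) * (z \<bullet> b) ^ (\<alpha> b - 1) * (\<Prod>b'\<in>Basis - {b}. (z \<bullet> b') ^ \<alpha> b')"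

lemma has_derivative_monomial:
  "(monomial \<alpha> has_derivative (\<lambda>h. \<Sum>b\<in>Basis. (h \<bullet> b) * monomial_deriv b \<alpha> z)) (at z)"
proof -
  have "((\<lambda>z. \<Prod>b\<in>Basis. (z \<bullet> b) ^ \<alpha> b) has_derivative
     (\<lambda>h. \<Sum>b\<in>Basis. (real (\<alpha> b) * (h \<bullet> b) * (z \<bullet> b) ^ (\<alpha> b - 1)) * (\<Prod>b'\<in>Basis - {b}. (z \<bullet> b') ^ \<alpha> b'))) (at z)"
    by (rule has_derivative_prod) (auto intro!: derivative_eq_intros)
  then show ?thesis
    unfolding monomial_def[abs_def] monomial_deriv_def by (simp add: algebra_simps)
qed

lemma monomial_deriv_shift:
  assumes "b \<in> Basis"
  shows "monomial_deriv b (\<alpha>(b := Suc (\<alpha> b))) z = real (Suc (\<alpha> b)) * monomial \<alpha> z"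
  using assms unfolding monomial_deriv_def monomial_def
  by (subst (2) prod.remove[of _ b]) (auto simp: fun_upd_def intro!: prod.cong)

lemma has_sum_shift:
  fixes z :: "'a::euclidean_space"
  assumes b: "b \<in> Basis" 
  shows "((\<lambda>\<alpha>. coeff_shift b c \<alpha> * monomial \<alpha> z) has_sum s) multi_indices \<longleftrightarrow>
         ((\<lambda>\<alpha>. c \<alpha> * monomial_deriv b \<alpha> z) has_sum s) multi_indices"
proof -
  let ?h = "\<lambda>\<alpha>::'a \<Rightarrow> nat. \<alpha>(b := Suc (\<alpha> b))"
  have inj: "inj_on ?h multi_indices"
  proof (rule inj_onI)
    fix \<alpha> \<beta> :: "'a \<Rightarrow> nat" assume "?h \<alpha> = ?h \<beta>"
    then have "?h \<alpha> x = ?h \<beta> x" for x by simp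
    then show "\<alpha> = \<beta>" by (metis Suc_inject ext fun_upd_other fun_upd_same)
  qed
  have sub: "?h ` multi_indices \<subseteq> multi_indices"
    using b by (auto simp: multi_indices_def)
  have im: "\<alpha> \<in> ?h ` multi_indices" if "\<alpha> \<in> multi_indices" "\<alpha> b \<noteq> 0" for \<alpha>
    using that by (intro image_eqI[of _ _ "\<alpha>(b := \<alpha> b - 1)"]) (auto simp: multi_indices_def)
  \<comment> \<open>The terms with exponent \<open>0\<close> at \<open>b\<close> are exactly those missed by the shift; they vanish.\<close>
  have "((\<lambda>\<alpha>. c \<alpha> * monomial_deriv b \<alpha> z) has_sum s) multi_indices \<longleftrightarrow>
        ((\<lambda>\<alpha>. c \<alpha> * monomial_deriv b \<alpha> z) has_sum s) (?h ` multi_indices)"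
    by (rule has_sum_cong_neutral) (use sub im in \<open>auto simp: monomial_deriv_def\<close>)
  also have "\<dots> \<longleftrightarrow> ((\<lambda>\<alpha>. c (?h \<alpha>) * monomial_deriv b (?h \<alpha>) z) has_sum s) multi_indices"
    by (subst has_sum_reindex[OF inj]) (simp add: o_def)
  also have "\<dots> \<longleftrightarrow> ((\<lambda>\<alpha>. coeff_shift b c \<alpha> * monomial \<alpha> z) has_sum s) multi_indices"
    by (rule has_sum_cong) (simp add: monomial_deriv_shift[OF b] coeff_shift_def algebra_simps)
  finally show ?thesis by simp
qed

text \<open>
  Enlarging the base by \<open>\<eta>\<close> pays for the factor \<open>k\<close> that differentiation produces, so that the
  differentiated series is dominated by the original one at a slightly larger point.
\<close>
lemma power_deriv_bound:
  fixes s \<eta> :: real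
  assumes "s \<ge> 0" "\<eta> > 0"
  shows "real k * s ^ (k - 1) \<le> (s + \<eta>) ^ k / \<eta>"
proof (cases k)
  case (Suc n)
  have "real (Suc n) * s ^ n * \<eta> \<le> (s + \<eta>) ^ Suc n" for n
  proof (induction n)
    case (Suc n)
    have "real (Suc (Suc n)) * s ^ Suc n * \<eta> = s * (real (Suc n) * s ^ n * \<eta>) + s ^ Suc n * \<eta>"
      by (simp add: algebra_simps)
    also have "\<dots> \<le> s * (s + \<eta>) ^ Suc n + (s + \<eta>) ^ Suc n * \<eta>"
      using Suc assms by (intro add_mono mult_left_mono mult_right_mono power_mono) auto
    finally show ?case by (simp add: algebra_simps)
  qed (use assms in auto)
  with Suc assms show ?thesis by (simp add: field_simps)
qed (use assms in auto)

lemma monomial_deriv_bound: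
  assumes b: "b \<in> Basis" and \<eta>: "\<eta> > 0" and s: "\<And>b. b \<in> Basis \<Longrightarrow> \<bar>z \<bullet> b\<bar> \<le> s b"
  shows "\<bar>monomial_deriv b \<alpha> z\<bar> \<le> monomial \<alpha> (\<Sum>b\<in>Basis. (s b + \<eta>) *\<^sub>R b) / \<eta>"
proof -
  have s0: "s b \<ge> 0" if "b \<in> Basis" for b using s[OF that] by linarith
  have "\<bar>monomial_deriv b \<alpha> z\<bar> = (real (\<alpha> b) * \<bar>z \<bullet> b\<bar> ^ (\<alpha> b - 1)) * (\<Prod>b'\<in>Basis - {b}. \<bar>z \<bullet> b'\<bar> ^ \<alpha> b')"
    by (simp add: monomial_deriv_def abs_mult abs_prod power_abs)
  also have "\<dots> \<le> (real (\<alpha> b) * s b ^ (\<alpha> b - 1)) * (\<Prod>b'\<in>Basis - {b}. (s b' + \<eta>) ^ \<alpha> b')"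
    using s s0 b \<eta> by (intro mult_mono power_mono prod_mono conjI prod_nonneg mult_nonneg_nonneg)
      (auto intro: order_trans[OF s])
  also have "\<dots> \<le> (s b + \<eta>) ^ \<alpha> b / \<eta> * (\<Prod>b'\<in>Basis - {b}. (s b' + \<eta>) ^ \<alpha> b')"
    using s0 b \<eta> by (intro mult_right_mono power_deriv_bound prod_nonneg) (auto simp: add_nonneg_nonneg)
  also have "\<dots> = monomial \<alpha> (\<Sum>b\<in>Basis. (s b + \<eta>) *\<^sub>R b) / \<eta>"
    unfolding monomial_def by (subst prod.remove[of _ b]) (use b in auto)
  finally show ?thesis .
qed

text \<open>
  Around \<open>x\<close> all terms of the differentiated series are dominated by the original series at one
  point \<open>a + w\<close>, whose coordinates exceed those of \<open>x\<close> (in absolute value, relative to \<open>a\<close>) by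
  \<open>2 * \<eta>\<close>.  For small \<open>\<eta>\<close> this point is still in the ball of convergence.
\<close>
lemma has_power_series_partials:
  assumes g: "has_power_series a r c g"
  obtains g' where "\<And>b. b \<in> Basis \<Longrightarrow> has_power_series a r (coeff_shift b c) (g' b)"
    "\<And>x. x \<in> ball a r \<Longrightarrow> (g has_derivative (\<lambda>h. \<Sum>b\<in>Basis. (h \<bullet> b) * g' b x)) (at x)"
proof
  define g' where "g' b x = (\<Sum>\<^sub>\<infinity>\<alpha>\<in>multi_indices. c \<alpha> * monomial_deriv b \<alpha> (x - a))" for b x
  have main: "\<exists>\<eta> M. \<eta> > 0 \<and> M summable_on multi_indices \<and> ball x \<eta> \<subseteq> ball a r \<and>
     (\<forall>y\<in>ball x \<eta>. \<forall>b\<in>Basis. \<forall>\<alpha>. \<bar>c \<alpha> * monomial_deriv b \<alpha> (y - a)\<bar> \<le> M \<alpha>)"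
    if x: "x \<in> ball a r" for x
  proof -
    define \<eta> where "\<eta> = (r - dist a x) / (2 * DIM('a) + 1)"
    have "r - dist a x > 0" using x by simp
    then have \<eta>: "\<eta> > 0" "dist a x + 2 * \<eta> * DIM('a) < r"
      unfolding \<eta>_def by (auto simp: field_simps add_pos_pos)
    define s where "s b = \<bar>(x - a) \<bullet> b\<bar> + \<eta>" for b
    define w where "w = (\<Sum>b\<in>Basis. (s b + \<eta>) *\<^sub>R (b::'a))"
    have "w = (\<Sum>b\<in>Basis. \<bar>(x - a) \<bullet> b\<bar> *\<^sub>R b) + (2 * \<eta>) *\<^sub>R (\<Sum>b\<in>Basis. b)"
      unfolding w_def s_def by (simp add: sum.distrib algebra_simps scaleR_sum_right flip: scaleR_2)
    moreover have "norm (\<Sum>b\<in>Basis. \<bar>(x - a) \<bullet> b\<bar> *\<^sub>R b) \<le> norm (x - a)"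
      by (rule norm_le_componentwise) simp
    moreover have "norm (\<Sum>b\<in>Basis. b::'a) \<le> DIM('a)"
      by (rule order_trans[OF norm_sum]) simp
    ultimately have "norm w \<le> norm (x - a) + 2 * \<eta> * DIM('a)"
      using \<eta>(1) by (auto intro!: norm_triangle_le add_mono)
    with \<eta> have "a + w \<in> ball a r" by (simp add: dist_norm norm_minus_commute)
    with g have "(\<lambda>\<alpha>. c \<alpha> * monomial \<alpha> w) summable_on multi_indices"
      unfolding has_power_series_def summable_on_def by fastforce
    then have "(\<lambda>\<alpha>. \<bar>c \<alpha> * monomial \<alpha> w\<bar>) summable_on multi_indices"
      by (simp only: summable_on_iff_abs_summable_on_real[of "\<lambda>\<alpha>. c \<alpha> * monomial \<alpha> w"] real_norm_def)
    then have "(\<lambda>\<alpha>. \<bar>c \<alpha> * monomial \<alpha> w\<bar> / \<eta>) summable_on multi_indices"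
      unfolding divide_inverse by (rule summable_on_cmult_left)
    moreover have "ball x \<eta> \<subseteq> ball a r"
    proof
      fix y assume "y \<in> ball x \<eta>"
      then have "dist a y < dist a x + \<eta>" using dist_triangle[of a y x] by simp
      also have "\<eta> \<le> 2 * \<eta> * DIM('a)"
      proof -
        have "1 \<le> 2 * real DIM('a)" using DIM_positive[where 'a='a] by linarith
        then have "\<eta> * 1 \<le> \<eta> * (2 * real DIM('a))" using \<eta>(1) by (intro mult_left_mono) auto
        then show ?thesis by (simp add: mult_ac)
      qed
      finally show "y \<in> ball a r" using \<eta> by simp
    qed
    moreover have "\<bar>c \<alpha> * monomial_deriv b \<alpha> (y - a)\<bar> \<le> \<bar>c \<alpha> * monomial \<alpha> w\<bar> / \<eta>"
      if y: "y \<in> ball x \<eta>" and b: "b \<in> Basis" for y b \<alpha>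
    proof -
      have "\<bar>(y - a) \<bullet> b\<bar> \<le> s b" if "b \<in> Basis" for b
      proof -
        have "\<bar>(y - x) \<bullet> b\<bar> \<le> \<eta>" using y Basis_le_norm[OF that, of "y - x"]
          by (simp add: dist_norm norm_minus_commute)
        moreover have "(y - a) \<bullet> b = (y - x) \<bullet> b + (x - a) \<bullet> b" by (simp add: algebra_simps)
        ultimately show ?thesis unfolding s_def by linarith
      qed
      from monomial_deriv_bound[where s=s and z="y - a" and \<alpha>=\<alpha>, OF b \<eta>(1) this]
      have "\<bar>monomial_deriv b \<alpha> (y - a)\<bar> \<le> \<bar>monomial \<alpha> w\<bar> / \<eta>"
        unfolding w_def using \<eta>(1) by (smt (verit) divide_right_mono)
      then show ?thesis by (simp add: abs_mult mult_left_mono flip: times_divide_eq_right)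
    qed
    ultimately show ?thesis using \<eta>(1) by blast
  qed
  have sums: "((\<lambda>\<alpha>. c \<alpha> * monomial_deriv b \<alpha> (x - a)) has_sum g' b x) multi_indices"
    if x: "x \<in> ball a r" and b: "b \<in> Basis" for x b
  proof -
    from main[OF x] obtain M where "M summable_on multi_indices"
      "\<And>\<alpha>. \<bar>c \<alpha> * monomial_deriv b \<alpha> (x - a)\<bar> \<le> M \<alpha>" using b by (meson centre_in_ball)
    then have "(\<lambda>\<alpha>. norm (c \<alpha> * monomial_deriv b \<alpha> (x - a))) summable_on multi_indices"
      by (intro Infinite_Sum.abs_summable_on_comparison_test'[of M]) auto
    then show ?thesis unfolding g'_def
      by (simp add: has_sum_infsum abs_summable_summable)
  qed
  show "has_power_series a r (coeff_shift b c) (g' b)" if "b \<in> Basis" for b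
    unfolding has_power_series_def using sums that by (simp add: has_sum_shift)
  show "(g has_derivative (\<lambda>h. \<Sum>b\<in>Basis. (h \<bullet> b) * g' b x)) (at x)" if x: "x \<in> ball a r" for x
  proof -
    from main[OF x] obtain \<eta> M where \<eta>: "\<eta> > 0" "M summable_on multi_indices" "ball x \<eta> \<subseteq> ball a r"
      "\<And>y b \<alpha>. y \<in> ball x \<eta> \<Longrightarrow> b \<in> Basis \<Longrightarrow> \<bar>c \<alpha> * monomial_deriv b \<alpha> (y - a)\<bar> \<le> M \<alpha>" by meson
    show ?thesis
    proof (rule has_derivative_has_sum[where S="ball x \<eta>" and I=multi_indices
          and f="\<lambda>\<alpha> y. c \<alpha> * monomial \<alpha> (y - a)" and M="\<lambda>\<alpha>. real DIM('a) * M \<alpha>"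
          and f'="\<lambda>\<alpha> y h. \<Sum>b\<in>Basis. (h \<bullet> b) * (c \<alpha> * monomial_deriv b \<alpha> (y - a))"])
      show "((\<lambda>y. c \<alpha> * monomial \<alpha> (y - a)) has_derivative
              (\<lambda>h. \<Sum>b\<in>Basis. (h \<bullet> b) * (c \<alpha> * monomial_deriv b \<alpha> (y - a)))) (at y)" for \<alpha> y
      proof -
        have "((\<lambda>y. monomial \<alpha> (y - a)) has_derivative
              (\<lambda>h. \<Sum>b\<in>Basis. (h \<bullet> b) * monomial_deriv b \<alpha> (y - a))) (at y)"
          by (rule has_derivative_compose[OF _ has_derivative_monomial, of "\<lambda>y. y - a" "\<lambda>h. h", simplified])
             (auto intro!: derivative_eq_intros)
        from has_derivative_mult_right[OF this, of "c \<alpha>"] show ?thesis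
          by (simp add: sum_distrib_left algebra_simps)
      qed
      show "\<bar>\<Sum>b\<in>Basis. (h \<bullet> b) * (c \<alpha> * monomial_deriv b \<alpha> (y - a))\<bar> \<le> real DIM('a) * M \<alpha> * norm h"
        if "y \<in> ball x \<eta>" for \<alpha> y h
      proof -
        have "\<bar>\<Sum>b\<in>Basis. (h \<bullet> b) * (c \<alpha> * monomial_deriv b \<alpha> (y - a))\<bar> \<le>
              (\<Sum>b\<in>(Basis::'a set). norm h * M \<alpha>)"
          by (rule order_trans[OF sum_abs], rule sum_mono, subst abs_mult,
              rule mult_mono[OF Basis_le_norm \<eta>(4)[OF that]]) auto
        then show ?thesis by (simp add: algebra_simps)
      qed
      show "((\<lambda>\<alpha>. c \<alpha> * monomial \<alpha> (y - a)) has_sum g y) multi_indices" if "y \<in> ball x \<eta>" for y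
        using that \<eta>(3) g by (auto simp: has_power_series_def)
      show "((\<lambda>\<alpha>. \<Sum>b\<in>Basis. (h \<bullet> b) * (c \<alpha> * monomial_deriv b \<alpha> (x - a))) has_sum
            (\<Sum>b\<in>Basis. (h \<bullet> b) * g' b x)) multi_indices" for h
        by (intro has_sum_sum has_sum_cmult_right sums[OF x])
      show "(\<lambda>\<alpha>. real DIM('a) * M \<alpha>) summable_on multi_indices"
        using \<eta>(2) by (rule summable_on_cmult_right)
      show "bounded_linear (\<lambda>h. \<Sum>b\<in>Basis. (h \<bullet> b) * g' b x)"
        by (intro bounded_linear_sum bounded_linear_mult_const bounded_linear_inner_left)
    qed (use \<eta>(1) in auto)
  qed
qed

definition dir_coeff :: "'a::euclidean_space \<Rightarrow> (('a \<Rightarrow> nat) \<Rightarrow> real) \<Rightarrow> ('a \<Rightarrow> nat) \<Rightarrow> real" where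
  "dir_coeff v c \<alpha> = (\<Sum>b\<in>Basis. (v \<bullet> b) * coeff_shift b c \<alpha>)"

lemma has_power_series_differentiable:
  assumes "has_power_series a r c g" "x \<in> ball a r"
  shows "g differentiable (at x)"
  by (rule has_power_series_partials[OF assms(1)]) (use assms(2) in \<open>blast intro: differentiableI\<close>)

lemma has_power_series_frechet_derivative:
  assumes "has_power_series a r c g"
  shows "has_power_series a r (dir_coeff v c) (\<lambda>x. frechet_derivative g (at x) v)"
proof -
  obtain g' where g': "\<And>b. b \<in> Basis \<Longrightarrow> has_power_series a r (coeff_shift b c) (g' b)"
    "\<And>x. x \<in> ball a r \<Longrightarrow> (g has_derivative (\<lambda>h. \<Sum>b\<in>Basis. (h \<bullet> b) * g' b x)) (at x)"
    by (rule has_power_series_partials[OF assms]) blast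
  show ?thesis unfolding has_power_series_def
  proof
    fix x assume x: "x \<in> ball a r"
    have "frechet_derivative g (at x) v = (\<Sum>b\<in>Basis. (v \<bullet> b) * g' b x)"
      using frechet_derivative_at[OF g'(2)[OF x]] by metis
    moreover have "((\<lambda>\<alpha>. \<Sum>b\<in>Basis. (v \<bullet> b) * (coeff_shift b c \<alpha> * monomial \<alpha> (x - a))) has_sum
        (\<Sum>b\<in>Basis. (v \<bullet> b) * g' b x)) multi_indices"
      using g'(1) x by (intro has_sum_sum has_sum_cmult_right) (auto simp: has_power_series_def)
    ultimately show "((\<lambda>\<alpha>. dir_coeff v c \<alpha> * monomial \<alpha> (x - a)) has_sum frechet_derivative g (at x) v) multi_indices"
      by (simp add: dir_coeff_def sum_distrib_right mult.assoc)
  qed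
qed

text \<open>
  Directional derivatives are again sums of power series on the same ball, so differentiability
  at every order follows by induction.
\<close>
lemma has_power_series_smooth_on:
  assumes "has_power_series a r c g"
  shows "smooth_on (ball a r) g"
proof -
  have "Ck_on k (ball a r) g" if "has_power_series a r c g" for k c g
    using that
  proof (induction k arbitrary: c g)
    case 0
    then show ?case using has_power_series_differentiable[OF 0]
      by (auto intro!: continuous_at_imp_continuous_on differentiable_imp_continuous_within)
  next
    case (Suc k)
    show ?case unfolding Ck_on.simps
      by (intro conjI ballI allI has_power_series_differentiable[OF Suc.prems]
          Suc.IH[OF has_power_series_frechet_derivative[OF Suc.prems]])
  qed
  with assms show ?thesis unfolding smooth_on_def by blast
qed

lemma coeff_shift_commute: "coeff_shift b (coeff_shift b' c) = coeff_shift b' (coeff_shift b c)"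
  by (rule ext) (auto simp: coeff_shift_def fun_upd_twist)

lemma dir_coeff_commute: "dir_coeff v (dir_coeff w c) = dir_coeff w (dir_coeff v c)"
proof (rule ext)
  have 1: "coeff_shift b (dir_coeff w c) \<alpha> = (\<Sum>b'\<in>Basis. (w \<bullet> b') * coeff_shift b (coeff_shift b' c) \<alpha>)" for b w \<alpha>
    by (simp add: dir_coeff_def coeff_shift_def sum_distrib_left algebra_simps)
  fix \<alpha>
  show "dir_coeff v (dir_coeff w c) \<alpha> = dir_coeff w (dir_coeff v c) \<alpha>"
    unfolding dir_coeff_def[of _ "dir_coeff _ _"] 1 sum_distrib_left
    by (subst sum.swap) (simp add: coeff_shift_commute[of _ _ c] algebra_simps)
qed

text \<open>
  Both mixed derivatives have the same coefficients.
\<close>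
lemma has_power_series_Hess_sym:
  assumes "has_power_series a r c g" "x \<in> ball a r"
  shows "Hess g x v w = Hess g x w v"
proof -
  have "((\<lambda>\<alpha>. dir_coeff w (dir_coeff v c) \<alpha> * monomial \<alpha> (x - a)) has_sum Hess g x v w) multi_indices" for v w
    using has_power_series_frechet_derivative[OF has_power_series_frechet_derivative[OF assms(1), of v], of w] assms(2)
    unfolding has_power_series_def Hess_def by auto
  from this[of v w] this[of w v] show ?thesis
    by (metis dir_coeff_commute infsumI)
qed

section \<open>Second-order calculus\<close>

text \<open>
  The Hessian as an endomorphism, so that it can be iterated.
\<close>
definition Hess_op :: "('a::euclidean_space \<Rightarrow> real) \<Rightarrow> 'a \<Rightarrow> 'a \<Rightarrow> 'a" where
  "Hess_op u x w = (\<Sum>b\<in>Basis. Hess u x b w *\<^sub>R b)"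

lemma frechet_derivative_eq_grad:
  fixes u :: "'a::euclidean_space \<Rightarrow> real"
  assumes "u differentiable (at x)"
  shows "frechet_derivative u (at x) v = grad u x \<bullet> v"
proof -
  have lin: "linear (frechet_derivative u (at x))"
    using assms linear_frechet_derivative by blast
  have "frechet_derivative u (at x) v = frechet_derivative u (at x) (\<Sum>b\<in>Basis. (v \<bullet> b) *\<^sub>R b)"
    by (simp add: euclidean_representation)
  also have "\<dots> = (\<Sum>b\<in>Basis. (v \<bullet> b) * frechet_derivative u (at x) b)"
    by (simp add: linear_sum[OF lin] linear_scale[OF lin])
  also have "\<dots> = grad u x \<bullet> v"
    by (simp add: grad_def inner_sum_right inner_commute[of _ v] mult.commute)
  finally show ?thesis .
qed

text \<open>
  Symmetry of the Hessian is one of the axioms; for sums of power series it is read off the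
  coefficients.
\<close>
locale C2_function =
  fixes D :: "'a::euclidean_space set" and u :: "'a \<Rightarrow> real"
  assumes open_domain: "open D"
    and differentiable: "x \<in> D \<Longrightarrow> u differentiable (at x)"
    and partial_differentiable:
      "x \<in> D \<Longrightarrow> (\<lambda>y. frechet_derivative u (at y) v) differentiable (at x)"
    and continuous_Hess: "continuous_on D (\<lambda>x. Hess u x v w)"
    and Hess_sym: "x \<in> D \<Longrightarrow> Hess u x v w = Hess u x w v"
begin

lemma has_derivative_grad_inner:
  assumes "x \<in> D"
  shows "(u has_derivative (\<lambda>v. grad u x \<bullet> v)) (at x)"
proof -
  have "(u has_derivative frechet_derivative u (at x)) (at x)"
    using differentiable[OF assms] frechet_derivative_works by blast
  moreover have "frechet_derivative u (at x) = (\<lambda>v. grad u x \<bullet> v)"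
    using frechet_derivative_eq_grad[OF differentiable[OF assms]] by blast
  ultimately show ?thesis by simp
qed

lemma has_derivative_partial:
  assumes "x \<in> D"
  shows "((\<lambda>y. frechet_derivative u (at y) v) has_derivative Hess u x v) (at x)"
  using partial_differentiable[OF assms, of v] frechet_derivative_works
  unfolding Hess_def[abs_def] by blast

lemma linear_Hess_right: "x \<in> D \<Longrightarrow> linear (Hess u x v)"
  using has_derivative_partial has_derivative_linear by blast

lemma linear_Hess_left:
  assumes "x \<in> D" shows "linear (\<lambda>v. Hess u x v w)"
proof -
  have "(\<lambda>v. Hess u x v w) = Hess u x w" using Hess_sym[OF assms] by blast
  then show ?thesis using linear_Hess_right[OF assms, of w] by simp
qed

lemma inner_Hess_op:
  assumes "x \<in> D" shows "v \<bullet> Hess_op u x w = Hess u x v w"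
proof -
  note lin = linear_Hess_left[OF assms]
  have "Hess u x v w = Hess u x (\<Sum>b\<in>Basis. (v \<bullet> b) *\<^sub>R b) w"
    by (simp add: euclidean_representation)
  also have "\<dots> = (\<Sum>b\<in>Basis. (v \<bullet> b) * Hess u x b w)"
    by (simp add: linear_sum[OF lin] linear_scale[OF lin])
  finally show ?thesis by (simp add: Hess_op_def inner_sum_right mult.commute)
qed

lemma Hess_op_self_adjoint:
  "x \<in> D \<Longrightarrow> Hess_op u x v \<bullet> w = v \<bullet> Hess_op u x w"
  using inner_Hess_op Hess_sym by (metis inner_commute)

lemma linear_Hess_op:
  assumes "x \<in> D" shows "linear (Hess_op u x)"
proof (rule linearI)
  note lin = linear_Hess_right[OF assms]
  show "Hess_op u x (v + w) = Hess_op u x v + Hess_op u x w" for v w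
    by (simp add: Hess_op_def linear_add[OF lin] scaleR_add_left sum.distrib)
  show "Hess_op u x (c *\<^sub>R v) = c *\<^sub>R Hess_op u x v" for c v
    by (simp add: Hess_op_def linear_scale[OF lin] scaleR_sum_right)
qed

lemma Hess_expand:
  assumes "x \<in> D"
  shows "Hess u x v w = (\<Sum>b\<in>Basis. \<Sum>b'\<in>Basis. (v \<bullet> b) * (w \<bullet> b') * Hess u x b b')"
proof -
  note lin = linear_Hess_right[OF assms]
  have 1: "Hess u x b w = (\<Sum>b'\<in>Basis. (w \<bullet> b') * Hess u x b b')" for b
  proof -
    have "Hess u x b w = Hess u x b (\<Sum>b'\<in>Basis. (w \<bullet> b') *\<^sub>R b')"
      by (simp add: euclidean_representation)
    then show ?thesis by (simp add: linear_sum[OF lin] linear_scale[OF lin])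
  qed
  have "Hess u x v w = v \<bullet> Hess_op u x w" using inner_Hess_op[OF assms] by simp
  also have "\<dots> = (\<Sum>b\<in>Basis. (v \<bullet> b) * Hess u x b w)"
    by (simp add: Hess_op_def inner_sum_right mult.commute)
  finally show ?thesis by (simp add: 1 sum_distrib_left mult.assoc)
qed

lemma laplacian_eq_trace: "x \<in> D \<Longrightarrow> laplacian u x = (\<Sum>b\<in>Basis. Hess_op u x b \<bullet> b)"
  unfolding laplacian_def using inner_Hess_op by (metis inner_commute)

lemma has_derivative_grad:
  assumes "x \<in> D"
  shows "(grad u has_derivative Hess_op u x) (at x)"
  unfolding grad_def[abs_def] Hess_op_def[abs_def]
  by (intro has_derivative_sum has_derivative_scaleR_left has_derivative_partial assms)

lemma tendsto_grad:
  assumes "(f \<longlongrightarrow> x) F" "x \<in> D"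
  shows "((\<lambda>t. grad u (f t)) \<longlongrightarrow> grad u x) F"
  using has_derivative_continuous[OF has_derivative_grad[OF assms(2)]] assms(1)
  by (rule isCont_tendsto_compose)

lemma tendsto_Hess:
  assumes f: "(f \<longlongrightarrow> x) F" and x: "x \<in> D" and "(g \<longlongrightarrow> v) F" "(h \<longlongrightarrow> w) F"
  shows "((\<lambda>t. Hess u (f t) (g t) (h t)) \<longlongrightarrow> Hess u x v w) F"
proof (rule Lim_transform_eventually)
  have 1: "((\<lambda>t. Hess u (f t) b b') \<longlongrightarrow> Hess u x b b') F" for b b'
  proof -
    have "isCont (\<lambda>x. Hess u x b b') x"
      using continuous_Hess[of b b'] continuous_on_eq_continuous_at[OF open_domain] x by blast
    then show ?thesis using f by (rule isCont_tendsto_compose)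
  qed
  show "((\<lambda>t. \<Sum>b\<in>Basis. \<Sum>b'\<in>Basis. (g t \<bullet> b) * (h t \<bullet> b') * Hess u (f t) b b') \<longlongrightarrow> Hess u x v w) F"
    by (subst Hess_expand[OF x]) (intro tendsto_intros assms 1)
  have "\<forall>\<^sub>F t in F. f t \<in> D" using topological_tendstoD[OF f open_domain x] .
  then show "\<forall>\<^sub>F t in F. (\<Sum>b\<in>Basis. \<Sum>b'\<in>Basis. (g t \<bullet> b) * (h t \<bullet> b') * Hess u (f t) b b')
      = Hess u (f t) (g t) (h t)"
    by eventually_elim (rule Hess_expand[symmetric])
qed

lemma tendsto_Hess_op:
  assumes "(f \<longlongrightarrow> x) F" "x \<in> D" "(h \<longlongrightarrow> w) F"
  shows "((\<lambda>t. Hess_op u (f t) (h t)) \<longlongrightarrow> Hess_op u x w) F"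
  unfolding Hess_op_def by (intro tendsto_intros tendsto_Hess assms)

lemma tendsto_laplacian:
  assumes "(f \<longlongrightarrow> x) F" "x \<in> D"
  shows "((\<lambda>t. laplacian u (f t)) \<longlongrightarrow> laplacian u x) F"
  unfolding laplacian_def by (intro tendsto_intros tendsto_Hess assms)

lemma Hess_uniform_near:
  assumes p: "p \<in> D" and \<epsilon>: "\<epsilon> > 0"
  obtains \<rho> where "\<rho> > 0" "ball p \<rho> \<subseteq> D"
    "\<And>q v. q \<in> ball p \<rho> \<Longrightarrow> \<bar>Hess u q v v - Hess u p v v\<bar> \<le> \<epsilon> * (v \<bullet> v)"
    "\<And>q. q \<in> ball p \<rho> \<Longrightarrow> \<bar>laplacian u q - laplacian u p\<bar> \<le> \<epsilon>"
proof -
  define \<epsilon>' where "\<epsilon>' = \<epsilon> / (real DIM('a))\<^sup>2"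
  have \<epsilon>': "\<epsilon>' > 0" unfolding \<epsilon>'_def using \<epsilon> by simp
  have "\<forall>\<^sub>F q in nhds p. \<forall>b\<in>Basis. \<forall>b'\<in>Basis. dist (Hess u q b b') (Hess u p b b') < \<epsilon>'"
    by (intro eventually_ball_finite ballI tendstoD[OF _ \<epsilon>'] tendsto_Hess[OF _ p] tendsto_const filterlim_ident) auto
  moreover have "\<forall>\<^sub>F q in nhds p. dist (laplacian u q) (laplacian u p) < \<epsilon>"
    by (intro tendstoD[OF _ \<epsilon>] tendsto_laplacian[OF _ p] filterlim_ident)
  moreover have "\<forall>\<^sub>F q in nhds p. q \<in> D" using open_domain p by (rule eventually_nhds_in_open)
  ultimately have "\<forall>\<^sub>F q in nhds p. (\<forall>b\<in>Basis. \<forall>b'\<in>Basis. dist (Hess u q b b') (Hess u p b b') < \<epsilon>') \<and>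
      dist (laplacian u q) (laplacian u p) < \<epsilon> \<and> q \<in> D"
    by eventually_elim auto
  then obtain \<rho> where \<rho>: "\<rho> > 0" "\<And>q. dist q p < \<rho> \<Longrightarrow>
      (\<forall>b\<in>Basis. \<forall>b'\<in>Basis. dist (Hess u q b b') (Hess u p b b') < \<epsilon>') \<and>
      dist (laplacian u q) (laplacian u p) < \<epsilon> \<and> q \<in> D"
    unfolding eventually_nhds_metric by blast
  have "\<bar>Hess u q v v - Hess u p v v\<bar> \<le> \<epsilon> * (v \<bullet> v)" if "q \<in> ball p \<rho>" for q v
  proof -
    have q: "dist q p < \<rho>" using that by (simp add: dist_commute)
    have "Hess u q v v - Hess u p v v =
        (\<Sum>b\<in>Basis. \<Sum>b'\<in>Basis. (v \<bullet> b) * (v \<bullet> b') * (Hess u q b b' - Hess u p b b'))"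
      using \<rho>(2)[OF q] by (simp add: Hess_expand[of _ v v] p sum_subtractf algebra_simps)
    also have "\<bar>\<dots>\<bar> \<le> (\<Sum>b\<in>(Basis::'a set). \<Sum>b'\<in>(Basis::'a set). norm v * norm v * \<epsilon>')"
    proof (intro order_trans[OF sum_abs] sum_mono)
      fix b b' :: 'a assume b: "b \<in> Basis" "b' \<in> Basis"
      then have "\<bar>Hess u q b b' - Hess u p b b'\<bar> \<le> \<epsilon>'"
        using \<rho>(2)[OF q] by (auto simp: dist_real_def intro: less_imp_le)
      then show "\<bar>(v \<bullet> b) * (v \<bullet> b') * (Hess u q b b' - Hess u p b b')\<bar> \<le> norm v * norm v * \<epsilon>'"
        unfolding abs_mult using b by (intro mult_mono Basis_le_norm) auto
    qed
    also have "\<dots> = \<epsilon> * (v \<bullet> v)"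
      by (simp add: \<epsilon>'_def dot_square_norm power2_eq_square)
    finally show ?thesis .
  qed
  moreover have "\<bar>laplacian u q - laplacian u p\<bar> \<le> \<epsilon>" if "q \<in> ball p \<rho>" for q
    using \<rho>(2)[of q] that by (auto simp: dist_real_def dist_commute)
  moreover have "ball p \<rho> \<subseteq> D" using \<rho>(2) by (auto simp: dist_commute)
  ultimately show ?thesis using that \<rho>(1) by blast
qed

lemma second_order_mean_value:
  assumes S: "convex S" "S \<subseteq> D" and x: "x \<in> S" and y: "y \<in> S"
  obtains \<xi> where "\<xi> \<in> S" "u y = u x + grad u x \<bullet> (y - x) + Hess u \<xi> (y - x) (y - x) / 2"
proof -
  let ?\<gamma> = "\<lambda>t. x + t *\<^sub>R (y - x)"
  define diff where "diff m t = (if m = 0 then u (?\<gamma> t) else if m = 1 then grad u (?\<gamma> t) \<bullet> (y - x)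
     else Hess u (?\<gamma> t) (y - x) (y - x))" for m :: nat and t :: real
  have inS: "?\<gamma> t \<in> S" if "0 \<le> t" "t \<le> 1" for t
    using convexD_alt[OF S(1) x y that] by (simp add: algebra_simps)
  have \<gamma>': "(?\<gamma> has_derivative (\<lambda>s. s *\<^sub>R (y - x))) (at t)" for t
    by (auto intro!: derivative_eq_intros)
  have "(diff m has_field_derivative diff (Suc m) t) (at t)" if "m < 2" "0 \<le> t" "t \<le> 1" for m t
  proof -
    have D: "?\<gamma> t \<in> D" using inS that S by auto
    have "((\<lambda>t. u (?\<gamma> t)) has_derivative (\<lambda>s. grad u (?\<gamma> t) \<bullet> (s *\<^sub>R (y - x)))) (at t)"
      by (rule has_derivative_compose[OF \<gamma>' has_derivative_grad_inner[OF D]])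
    moreover have "((\<lambda>t. grad u (?\<gamma> t) \<bullet> (y - x)) has_derivative
        (\<lambda>s. Hess_op u (?\<gamma> t) (s *\<^sub>R (y - x)) \<bullet> (y - x))) (at t)"
      by (intro has_derivative_inner_left has_derivative_compose[OF \<gamma>' has_derivative_grad[OF D]])
    moreover have "Hess_op u (?\<gamma> t) (s *\<^sub>R (y - x)) \<bullet> (y - x) = Hess u (?\<gamma> t) (y - x) (y - x) * s" for s
      using inner_Hess_op[OF D] linear_scale[OF linear_Hess_op[OF D]] by (simp add: inner_commute)
    moreover have "m = 0 \<or> m = 1" using that by auto
    ultimately show ?thesis
      unfolding has_field_derivative_def diff_def[abs_def] by (auto simp: mult_commute_abs)
  qed
  then obtain t where t: "0 < t" "t < 1"
    "u (?\<gamma> 1) = (\<Sum>m<2. diff m 0 / fact m * (1 - 0) ^ m) + diff 2 t / fact 2 * (1 - 0) ^ 2"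
    using Taylor_up[of 2 diff "\<lambda>t. u (?\<gamma> t)" 0 1 0] by (auto simp: diff_def[abs_def])
  show ?thesis
  proof
    show "?\<gamma> t \<in> S" using inS t by simp
    show "u y = u x + grad u x \<bullet> (y - x) + Hess u (?\<gamma> t) (y - x) (y - x) / 2"
      using t(3) by (simp add: diff_def numeral_2_eq_2)
  qed
qed

lemma cong:
  assumes V: "open V" "V \<subseteq> D" and eq: "\<And>y. y \<in> V \<Longrightarrow> h y = u y"
  shows "C2_function V h" and "x \<in> V \<Longrightarrow> grad h x = grad u x" and "x \<in> V \<Longrightarrow> Hess h x = Hess u x"
proof -
  have d1: "frechet_derivative h (at x) = frechet_derivative u (at x)" if "x \<in> V" for x
    using frechet_derivative_transform_within_open[of u x V h] differentiable V eq that by auto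
  have d2: "frechet_derivative (\<lambda>y. frechet_derivative h (at y) v) (at x)
      = frechet_derivative (\<lambda>y. frechet_derivative u (at y) v) (at x)" if "x \<in> V" for x v
    using frechet_derivative_transform_within_open[of "\<lambda>y. frechet_derivative u (at y) v" x V
        "\<lambda>y. frechet_derivative h (at y) v"] partial_differentiable V d1 that by auto
  show grad: "grad h x = grad u x" if "x \<in> V" for x
    unfolding grad_def using d1[OF that] by simp
  show Hess: "Hess h x = Hess u x" if "x \<in> V" for x
    by (intro ext) (simp add: Hess_def d2[OF that])
  have tr: "g differentiable (at x)" if "f differentiable (at x)" "x \<in> V" "\<And>y. y \<in> V \<Longrightarrow> f y = g y"
    for f g :: "'a \<Rightarrow> real" and x
    using that V(1) has_derivative_transform_within_open unfolding differentiable_def by metis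
  show "C2_function V h"
  proof
    show "continuous_on V (\<lambda>x. Hess h x v w)" for v w
      using continuous_on_subset[OF continuous_Hess V(2)] by (rule continuous_on_eq) (simp add: Hess)
    show "h differentiable at x" if "x \<in> V" for x
      by (rule tr[OF differentiable]) (use V eq that in auto)
    show "(\<lambda>y. frechet_derivative h (at y) v) differentiable at x" if "x \<in> V" for x v
      by (rule tr[OF partial_differentiable]) (use V d1 that in auto)
  qed (use V Hess Hess_sym in auto)
qed

text \<open>
  The divergence of \<open>\<nabla>u / \<bar>\<nabla>u\<bar>\<close> is \<open>(\<Delta>u - Hess\<^sub>u(\<nu>, \<nu>)) / \<bar>\<nabla>u\<bar>\<close>, and the term \<open>\<langle>D\<^sub>\<nu> \<nu>, \<nu>\<rangle>\<close> vanishes as \<open>\<nu>\<close>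
  has constant length.
\<close>
lemma mean_curvature_unit_grad:
  assumes y: "y \<in> D" and G: "grad u y \<noteq> 0"
    and V: "open V" "y \<in> V" and N: "\<And>z. z \<in> V \<Longrightarrow> N z = unit_grad u z"
  shows "mean_curvature N y
    = (laplacian u y - Hess u y (unit_grad u y) (unit_grad u y)) / norm (grad u y)"
proof -
  define g where "g = norm (grad u y)"
  define \<nu> where "\<nu> = unit_grad u y"
  define A where "A = Hess_op u y"
  have g: "g > 0" using G by (simp add: g_def)
  have \<nu>: "grad u y = g *\<^sub>R \<nu>" "\<nu> \<bullet> \<nu> = 1" "sgn (grad u y) = \<nu>"
    using G by (simp_all add: \<nu>_def g_def unit_grad_def sgn_div_norm dot_square_norm power2_eq_square)
  define D' where "D' w = (1 / g) *\<^sub>R (A w - (\<nu> \<bullet> A w) *\<^sub>R \<nu>)" for w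
  have "((\<lambda>z. grad u z /\<^sub>R norm (grad u z)) has_derivative D') (at y)"
  proof -
    have n: "((\<lambda>z. norm (grad u z)) has_derivative (\<lambda>w. \<nu> \<bullet> A w)) (at y)"
      using has_derivative_compose[OF has_derivative_grad[OF y] has_derivative_norm[OF G]]
      by (simp add: \<nu>(3) A_def inner_commute[of \<nu>])
    have inv: "((\<lambda>z. inverse (norm (grad u z))) has_derivative
        (\<lambda>w. - (inverse (norm (grad u y)) * (\<nu> \<bullet> A w) * inverse (norm (grad u y))))) (at y)"
      by (rule Deriv.has_derivative_inverse[OF _ n]) (use G in simp)
    have "((\<lambda>z. grad u z /\<^sub>R norm (grad u z)) has_derivative
        (\<lambda>w. inverse (norm (grad u y)) *\<^sub>R A w
           + (- (inverse (norm (grad u y)) * (\<nu> \<bullet> A w) * inverse (norm (grad u y)))) *\<^sub>R grad u y)) (at y)"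
      by (rule has_derivative_scaleR[OF inv has_derivative_grad[OF y, folded A_def]])
    moreover have "(\<lambda>w. inverse (norm (grad u y)) *\<^sub>R A w
           + (- (inverse (norm (grad u y)) * (\<nu> \<bullet> A w) * inverse (norm (grad u y)))) *\<^sub>R grad u y) = D'"
    proof
      fix w
      have "inverse g * (\<nu> \<bullet> A w) * inverse g * g = inverse g * (\<nu> \<bullet> A w)" using g by simp
      then show "inverse (norm (grad u y)) *\<^sub>R A w
           + (- (inverse (norm (grad u y)) * (\<nu> \<bullet> A w) * inverse (norm (grad u y)))) *\<^sub>R grad u y = D' w"
        unfolding D'_def g_def[symmetric] by (subst \<nu>(1)) (simp add: scaleR_diff_right divide_inverse)
    qed
    ultimately show ?thesis by simp
  qed
  then have "(unit_grad u has_derivative D') (at y)" by (simp add: unit_grad_def[abs_def])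
  then have "(N has_derivative D') (at y)"
    using has_derivative_transform_within_open[OF _ V] N by metis
  then have fN: "frechet_derivative N (at y) = D'" using frechet_derivative_at by metis
  have "(\<Sum>b\<in>Basis. (\<nu> \<bullet> A b) * (\<nu> \<bullet> b)) = \<nu> \<bullet> A \<nu>"
    using Hess_op_self_adjoint[OF y] unfolding A_def
    by (simp add: euclidean_inner[of "Hess_op u y \<nu>" \<nu>] flip: Hess_op_self_adjoint[OF y])
  then have "(\<Sum>b\<in>Basis. D' b \<bullet> b) = (laplacian u y - \<nu> \<bullet> A \<nu>) / g"
    unfolding laplacian_eq_trace[OF y] A_def D'_def
    by (simp add: inner_simps sum_subtractf flip: sum_divide_distrib)
  moreover have "D' \<nu> \<bullet> \<nu> = 0"
    by (simp add: D'_def inner_simps \<nu>(2) inner_commute)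
  ultimately show ?thesis
    unfolding mean_curvature_def fN using N[OF V(2)]
    by (simp add: g_def \<nu>_def A_def inner_Hess_op[OF y])
qed

end

lemma C2_function_glue:
  assumes D: "open D" and loc: "\<And>x. x \<in> D \<Longrightarrow> \<exists>V. x \<in> V \<and> C2_function V u"
  shows "C2_function D u"
proof
  show "continuous_on D (\<lambda>x. Hess u x v w)" for v w
  proof (intro continuous_at_imp_continuous_on ballI)
    fix x assume "x \<in> D"
    then obtain V where V: "x \<in> V" "C2_function V u" using loc by blast
    then show "isCont (\<lambda>x. Hess u x v w) x"
      using C2_function.continuous_Hess C2_function.open_domain continuous_on_eq_continuous_at by blast
  qed
qed (use D loc C2_function.differentiable C2_function.partial_differentiable C2_function.Hess_sym in blast)+

lemma Ck_on_cong:
  assumes "open U" "\<And>x. x \<in> U \<Longrightarrow> f x = g x" "Ck_on k U f"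
  shows "Ck_on k U g"
  using assms
proof (induction k arbitrary: f g)
  case 0
  then show ?case using continuous_on_cong[of U U f g] by simp
next
  case (Suc k)
  have df: "f differentiable (at x)" if "x \<in> U" for x using Suc.prems that by simp
  have eq: "frechet_derivative f (at x) = frechet_derivative g (at x)" if "x \<in> U" for x
    using frechet_derivative_transform_within_open[OF df] Suc.prems that by blast
  have "g differentiable (at x)" if "x \<in> U" for x
    using df[OF that] that Suc.prems has_derivative_transform_within_open unfolding differentiable_def by metis
  moreover have "Ck_on k U (\<lambda>x. frechet_derivative g (at x) v)" for v
    by (rule Suc.IH[of "\<lambda>x. frechet_derivative f (at x) v"]) (use Suc.prems eq in auto)
  ultimately show ?case by simp
qed

lemma Ck_on_glue:
  assumes "\<And>x. x \<in> U \<Longrightarrow> \<exists>V. open V \<and> x \<in> V \<and> Ck_on k V f"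
  shows "Ck_on k U f"
  using assms
proof (induction k arbitrary: f)
  case 0
  then show ?case
    by (auto intro!: continuous_at_imp_continuous_on) (metis continuous_on_eq_continuous_at)
next
  case (Suc k)
  show ?case
    unfolding Ck_on.simps
  proof (intro conjI ballI allI Suc.IH)
    fix x assume "x \<in> U"
    then show "f differentiable (at x)" using Suc.prems by fastforce
  next
    fix v x assume "x \<in> U"
    then show "\<exists>V. open V \<and> x \<in> V \<and> Ck_on k V (\<lambda>x. frechet_derivative f (at x) v)"
      using Suc.prems by fastforce
  qed
qed

text \<open>
  For \<open>c = -1\<close> this is the space-time defining function of a level set flow.  Arbitrary \<open>c\<close> and \<open>d\<close>
  make the class closed under differentiation, which the induction requires.
\<close>
lemma Ck_on_affine_in_second:
  fixes f :: "'a::euclidean_space \<Rightarrow> real"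
  assumes U: "open U" and I: "open I" and f: "Ck_on k U f"
  shows "Ck_on k (U \<times> I) (\<lambda>z. f (fst z) + c * snd z + d)"
  using f
proof (induction k arbitrary: f c d)
  case 0
  then have "continuous_on U f" by simp
  then have "continuous_on (U \<times> I) (\<lambda>z. f (fst z))"
    by (rule continuous_on_compose2[where f=fst]) (auto simp: continuous_on_fst continuous_on_id)
  then show ?case
    unfolding Ck_on.simps by (intro continuous_on_add continuous_on_mult_left continuous_on_const
        continuous_on_snd continuous_on_id)
next
  case (Suc k)
  let ?F = "\<lambda>z. f (fst z) + c * snd z + d"
  have der: "(?F has_derivative (\<lambda>w. frechet_derivative f (at (fst z)) (fst w) + c * snd w)) (at z)"
    if "z \<in> U \<times> I" for z
  proof -
    have "f differentiable (at (fst z))" using Suc.prems that by auto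
    then have "(f has_derivative frechet_derivative f (at (fst z))) (at (fst z))"
      using frechet_derivative_works by blast
    from has_derivative_compose[OF has_derivative_fst[OF has_derivative_ident] this]
    show ?thesis by (auto intro!: derivative_eq_intros)
  qed
  have "Ck_on k (U \<times> I) (\<lambda>z. frechet_derivative ?F (at z) w)" for w
  proof (rule Ck_on_cong)
    show "open (U \<times> I)" using U I by (rule open_Times)
    show "Ck_on k (U \<times> I) (\<lambda>z. frechet_derivative f (at (fst z)) (fst w) + 0 * snd z + c * snd w)"
      by (rule Suc.IH) (use Suc.prems in simp)
    show "frechet_derivative f (at (fst z)) (fst w) + 0 * snd z + c * snd w = frechet_derivative ?F (at z) w"
      if "z \<in> U \<times> I" for z
      using fun_cong[OF frechet_derivative_at[OF der[OF that]], of w] by simp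
  qed
  moreover have "?F differentiable (at z)" if "z \<in> U \<times> I" for z
    using der[OF that] by (rule differentiableI)
  ultimately show ?case by simp
qed

section \<open>Real analytic functions are smooth in the interior\<close>

lemma has_power_series_C2_function:
  assumes "has_power_series a r c g"
  shows "C2_function (ball a r) g"
proof
  show "continuous_on (ball a r) (\<lambda>x. Hess g x v w)" for v w
    unfolding Hess_def
    using has_power_series_differentiable[OF has_power_series_frechet_derivative[OF
        has_power_series_frechet_derivative[OF assms]]]
    by (intro continuous_at_imp_continuous_on ballI differentiable_imp_continuous_within)
qed (use assms in \<open>auto intro: has_power_series_differentiable has_power_series_Hess_sym
      has_power_series_frechet_derivative\<close>)

lemma real_analytic_on_power_series:
  assumes "real_analytic_on S f" "a \<in> S"
  obtains r c g where "r > 0" "has_power_series a r c g" "\<And>x. x \<in> S \<inter> ball a r \<Longrightarrow> f x = g x"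
proof -
  obtain r c g where "r > 0" "\<forall>x\<in>ball a r. ((\<lambda>\<alpha>. c \<alpha> * (\<Prod>b\<in>Basis. ((x - a) \<bullet> b) ^ \<alpha> b)) has_sum g x)
             {\<alpha>. \<forall>b. b \<notin> Basis \<longrightarrow> \<alpha> b = 0}" "\<forall>x\<in>S \<inter> ball a r. f x = g x"
    using assms(1)[unfolded real_analytic_on_def, rule_format, OF assms(2)] by (elim exE conjE)
  then show ?thesis
    by (intro that[of r c g]) (auto simp: has_power_series_def monomial_def multi_indices_def)
qed

lemma analytic_interior_local:
  assumes "real_analytic_on S f" "x \<in> interior S"
  obtains r c g where "r > 0" "ball x r \<subseteq> interior S" "has_power_series x r c g"
    "\<And>y. y \<in> ball x r \<Longrightarrow> f y = g y"
proof -
  obtain r c g where r: "r > 0" "has_power_series x r c g" "\<And>y. y \<in> S \<inter> ball x r \<Longrightarrow> f y = g y"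
    using real_analytic_on_power_series[OF assms(1)] assms(2) interior_subset by blast
  obtain r' where r': "r' > 0" "ball x r' \<subseteq> interior S"
    using assms(2) open_interior openE by blast
  show ?thesis
  proof
    show "min r r' > 0" using r r' by simp
    show "ball x (min r r') \<subseteq> interior S" using r' by auto
    show "has_power_series x (min r r') c g" using r(2) by (auto simp: has_power_series_def)
    show "f y = g y" if "y \<in> ball x (min r r')" for y
      using that r(3) r'(2) interior_subset by (auto simp: subset_iff)
  qed
qed

lemma analytic_smooth_on_interior:
  assumes "real_analytic_on S f"
  shows "smooth_on (interior S) f"
  unfolding smooth_on_def
proof (intro allI Ck_on_glue)
  fix k x assume "x \<in> interior S"
  then obtain r c g where r: "r > 0" "has_power_series x r c g" "\<And>y. y \<in> ball x r \<Longrightarrow> f y = g y"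
    using analytic_interior_local[OF assms] by metis
  have "Ck_on k (ball x r) f"
    by (rule Ck_on_cong[of _ g]) (use r has_power_series_smooth_on[OF r(2)] in \<open>auto simp: smooth_on_def\<close>)
  then show "\<exists>V. open V \<and> x \<in> V \<and> Ck_on k V f" using r(1) by (intro exI[of _ "ball x r"]) simp
qed

lemma analytic_C2_interior:
  assumes "real_analytic_on S f"
  shows "C2_function (interior S) f"
proof (rule C2_function_glue)
  fix x assume "x \<in> interior S"
  then obtain r c g where r: "r > 0" "has_power_series x r c g" "\<And>y. y \<in> ball x r \<Longrightarrow> f y = g y"
    using analytic_interior_local[OF assms] by metis
  have "C2_function (ball x r) f"
    using C2_function.cong(1)[OF has_power_series_C2_function[OF r(2)] open_ball subset_refl] r(3) by blast
  then show "\<exists>V. x \<in> V \<and> C2_function V f" using r(1) centre_in_ball by blast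
qed simp

section \<open>The Hessian of the arrival time at an interior critical point\<close>

text \<open>
  By polarisation the form \<open>\<langle>A x, y\<rangle> - \<kappa> \<langle>x, y\<rangle>\<close> vanishes on the range of \<open>A\<close>, which \<open>A\<close> maps to itself.
\<close>
lemma self_adjoint_square_eq:
  fixes A :: "'a::euclidean_space \<Rightarrow> 'a"
  assumes A: "linear A" "\<And>x y. A x \<bullet> y = x \<bullet> A y"
    and eq: "\<And>e. A (A e) \<bullet> A e = \<kappa> * (A e \<bullet> A e)"
  shows "A (A e) = \<kappa> *\<^sub>R A e"
proof -
  have polar: "A (A e) \<bullet> A f = \<kappa> * (A e \<bullet> A f)" for e f
  proof -
    have "A (A f) \<bullet> A e = A (A e) \<bullet> A f" using A(2) by (metis inner_commute)
    with eq[of "e + f"] eq[of e] eq[of f] show ?thesis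
      by (simp add: linear_add[OF A(1)] inner_simps inner_commute[of "A f" "A e"] algebra_simps)
  qed
  have "(A (A e) - \<kappa> *\<^sub>R A e) \<bullet> (A (A e) - \<kappa> *\<^sub>R A e) = 0"
    using polar[of e "A e"] polar[of e e] by (simp add: inner_simps algebra_simps)
  then show ?thesis by simp
qed

text \<open>
  For an eigenvector \<open>w\<close> in the range, Cauchy's inequality gives \<open>\<kappa>\<^sup>2 \<le> tr A\<^sup>2 = \<kappa> tr A = \<kappa> (\<kappa> - 1)\<close>,
  and \<open>\<kappa> = 0\<close> would mean \<open>A\<^sup>2 = 0\<close>, hence \<open>A = 0\<close>.
\<close>
lemma negative_eigenvalue:
  fixes A :: "'a::euclidean_space \<Rightarrow> 'a"
  assumes A: "linear A" "\<And>x y. A x \<bullet> y = x \<bullet> A y"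
    and sq: "\<And>e. A (A e) = \<kappa> *\<^sub>R A e"
    and tr: "(\<Sum>b\<in>Basis. A b \<bullet> b) = \<kappa> - 1" and nz: "A e \<noteq> 0"
  shows "\<kappa> < 0"
proof -
  have "\<kappa> \<noteq> 0"
  proof
    assume "\<kappa> = 0"
    then have "A e \<bullet> A e = 0" using sq A(2)[of e "A e"] by simp
    with nz show False by simp
  qed
  define w where "w = A e"
  have w: "w \<bullet> w > 0" "A w = \<kappa> *\<^sub>R w" using nz sq by (auto simp: w_def)
  have Ab: "A b \<bullet> w = \<kappa> * (w \<bullet> b)" "A b \<bullet> A b = \<kappa> * (A b \<bullet> b)" for b
    using A(2)[of b w] A(2)[of b "A b"] w(2) sq[of b] by (simp_all add: inner_commute)
  have "\<kappa>\<^sup>2 * (w \<bullet> w) = \<kappa>\<^sup>2 * (\<Sum>b\<in>Basis. (w \<bullet> b) * (w \<bullet> b))"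
    by (subst euclidean_inner) simp
  also have "\<dots> = (\<Sum>b\<in>Basis. (A b \<bullet> w)\<^sup>2)"
    unfolding Ab sum_distrib_left by (intro sum.cong) (auto simp: power2_eq_square)
  also have "\<dots> \<le> (\<Sum>b\<in>Basis. (A b \<bullet> A b) * (w \<bullet> w))"
    by (intro sum_mono Cauchy_Schwarz_ineq)
  also have "\<dots> = \<kappa> * (\<kappa> - 1) * (w \<bullet> w)"
    unfolding Ab(2) sum_distrib_right[symmetric] sum_distrib_left[symmetric] tr ..
  finally have "\<kappa>\<^sup>2 \<le> \<kappa> * (\<kappa> - 1)" using w(1) by (simp add: mult_le_cancel_right)
  with \<open>\<kappa> \<noteq> 0\<close> show ?thesis by (simp add: power2_eq_square algebra_simps)
qed

text \<open>
  Multiplied by \<open>\<bar>\<nabla>u\<bar>\<^sup>2\<close>, the arrival time equation is meaningful at critical points too and can be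
  rescaled and passed to limits.  What the viscosity inequalities say beyond it, at critical points,
  is that the Hessian is not zero.
\<close>
locale C2_arrival = C2_function D u for D :: "'a::euclidean_space set" and u +
  assumes pde: "x \<in> D \<Longrightarrow>
      (grad u x \<bullet> grad u x) * (laplacian u x + 1) = Hess u x (grad u x) (grad u x)"
    and Hess_nonzero: "x \<in> D \<Longrightarrow> grad u x = 0 \<Longrightarrow> \<exists>e. Hess_op u x e \<noteq> 0"
begin

lemma grad_blow_up:
  assumes p: "p \<in> D" "grad u p = 0"
  shows "((\<lambda>s. (1 / s) *\<^sub>R grad u (p + s *\<^sub>R e)) \<longlongrightarrow> Hess_op u p e) (at 0)"
  unfolding tendsto_componentwise_iff[where l="Hess_op u p e"]
proof
  fix b :: 'a assume "b \<in> Basis"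
  have "((\<lambda>s. grad u (p + s *\<^sub>R e) \<bullet> b) has_derivative (\<lambda>s. Hess_op u p (s *\<^sub>R e) \<bullet> b)) (at 0)"
    by (intro has_derivative_inner_left has_derivative_compose[where g="grad u" and f="\<lambda>s. p + s *\<^sub>R e"])
       (use has_derivative_grad[OF p(1)] in \<open>auto intro!: derivative_eq_intros\<close>)
  then have "((\<lambda>s. grad u (p + s *\<^sub>R e) \<bullet> b) has_field_derivative (Hess_op u p e \<bullet> b)) (at 0)"
    unfolding has_field_derivative_def
    by (simp add: linear_scale[OF linear_Hess_op[OF p(1)]] mult_commute_abs)
  then show "((\<lambda>s. (1 / s) *\<^sub>R grad u (p + s *\<^sub>R e) \<bullet> b) \<longlongrightarrow> Hess_op u p e \<bullet> b) (at 0)"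
    unfolding has_field_derivative_iff by (simp add: p(2))
qed

text \<open>
  Divide the equation at \<open>p + s e\<close> by \<open>s\<^sup>2\<close> and let \<open>s\<close> tend to \<open>0\<close>.
\<close>
lemma Hess_op_square:
  assumes p: "p \<in> D" "grad u p = 0"
  shows "Hess_op u p (Hess_op u p e) = (laplacian u p + 1) *\<^sub>R Hess_op u p e"
proof (rule self_adjoint_square_eq[OF linear_Hess_op Hess_op_self_adjoint])
  fix e
  let ?G = "\<lambda>s. (1 / s) *\<^sub>R grad u (p + s *\<^sub>R e)"
  have q: "((\<lambda>s. p + s *\<^sub>R e) \<longlongrightarrow> p) (at 0)"
    by (auto intro!: tendsto_eq_intros)
  have G: "(?G \<longlongrightarrow> Hess_op u p e) (at 0)" by (rule grad_blow_up[OF p])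
  have 1: "((\<lambda>s. (?G s \<bullet> ?G s) * (laplacian u (p + s *\<^sub>R e) + 1)) \<longlongrightarrow>
      (Hess_op u p e \<bullet> Hess_op u p e) * (laplacian u p + 1)) (at 0)"
    by (intro tendsto_intros tendsto_laplacian G q p)
  have 2: "((\<lambda>s. Hess u (p + s *\<^sub>R e) (?G s) (?G s)) \<longlongrightarrow>
      Hess u p (Hess_op u p e) (Hess_op u p e)) (at 0)"
    by (intro tendsto_Hess G q p)
  have "\<forall>\<^sub>F s in at 0. p + s *\<^sub>R e \<in> D"
    using topological_tendstoD[OF q open_domain p(1)] .
  then have "\<forall>\<^sub>F s in at 0. (?G s \<bullet> ?G s) * (laplacian u (p + s *\<^sub>R e) + 1)
      = Hess u (p + s *\<^sub>R e) (?G s) (?G s)"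
  proof eventually_elim
    case (elim s)
    show ?case using pde[OF elim]
      by (simp add: linear_scale[OF linear_Hess_left[OF elim]] linear_scale[OF linear_Hess_right[OF elim]])
  qed
  from tendsto_unique[OF _ Lim_transform_eventually[OF 1 this] 2]
  show "Hess_op u p (Hess_op u p e) \<bullet> Hess_op u p e = (laplacian u p + 1) * (Hess_op u p e \<bullet> Hess_op u p e)"
    using inner_Hess_op[OF p(1)] by (simp add: inner_commute mult.commute)
qed (use p in auto)

lemma laplacian_less:
  assumes p: "p \<in> D" "grad u p = 0"
  shows "laplacian u p + 1 < 0"
proof -
  obtain e where "Hess_op u p e \<noteq> 0" using Hess_nonzero[OF p] by blast
  moreover have "(\<Sum>b\<in>Basis. Hess_op u p b \<bullet> b) = (laplacian u p + 1) - 1"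
    by (simp add: laplacian_eq_trace[OF p(1)])
  ultimately show ?thesis
    using negative_eigenvalue[OF linear_Hess_op[OF p(1)] Hess_op_self_adjoint[OF p(1)] Hess_op_square[OF p]]
    by blast
qed

end

text \<open>
  A smooth \<open>u\<close> touches itself from above and from below, so both viscosity inequalities apply with
  \<open>u\<close> as test function.  At a critical point with zero Hessian the supersolution inequality would
  read \<open>0 \<le> -1\<close>.
\<close>
lemma arrival_equation:
  assumes visc: "viscosity_solution D u" and smooth: "smooth_on D u" and C2: "C2_function D u"
  shows "C2_arrival D u"
    and "x \<in> D \<Longrightarrow> grad u x \<noteq> 0 \<Longrightarrow>
      laplacian u x - Hess u x (unit_grad u x) (unit_grad u x) = -1"
proof -
  interpret C2_function D u by fact
  have touch: "\<forall>\<^sub>F y in nhds x. u y - u y \<le> u x - u x" "\<forall>\<^sub>F y in nhds x. u y - u y \<ge> u x - u x" for x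
    by auto
  have sub: "if grad u x \<noteq> 0 then laplacian u x - Hess u x (unit_grad u x) (unit_grad u x) \<ge> -1
      else \<exists>v. norm v \<le> 1 \<and> laplacian u x - Hess u x v v \<ge> -1" if "x \<in> D" for x
    using visc smooth that touch(1)[of x] unfolding viscosity_solution_def viscosity_subsolution_def by blast
  have super: "if grad u x \<noteq> 0 then laplacian u x - Hess u x (unit_grad u x) (unit_grad u x) \<le> -1
      else \<exists>v. norm v \<le> 1 \<and> laplacian u x - Hess u x v v \<le> -1" if "x \<in> D" for x
    using visc smooth that touch(2)[of x] unfolding viscosity_solution_def viscosity_supersolution_def by blast
  show eq: "laplacian u x - Hess u x (unit_grad u x) (unit_grad u x) = -1"
    if "x \<in> D" "grad u x \<noteq> 0" for x
    using sub[OF that(1)] super[OF that(1)] that(2) by auto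
  show "C2_arrival D u"
  proof
    fix x assume x: "x \<in> D"
    show "(grad u x \<bullet> grad u x) * (laplacian u x + 1) = Hess u x (grad u x) (grad u x)"
    proof (cases "grad u x = 0")
      case True
      then show ?thesis using linear_0[OF linear_Hess_right[OF x]] by simp
    next
      case False
      then have "grad u x = norm (grad u x) *\<^sub>R unit_grad u x" by (simp add: unit_grad_def)
      then have "Hess u x (grad u x) (grad u x)
          = norm (grad u x) * (norm (grad u x) * Hess u x (unit_grad u x) (unit_grad u x))"
        using linear_scale[OF linear_Hess_right[OF x]] linear_scale[OF linear_Hess_left[OF x]]
        by (metis real_scaleR_def)
      then show ?thesis using eq[OF x False]
        by (simp add: dot_square_norm power2_eq_square algebra_simps)
    qed
    show "\<exists>e. Hess_op u x e \<noteq> 0" if G: "grad u x = 0"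
    proof (rule ccontr)
      assume "\<not> ?thesis"
      then have 0: "Hess_op u x e = 0" for e by blast
      have "Hess u x v v = 0" for v using inner_Hess_op[OF x, of v v] by (simp add: 0)
      moreover have "laplacian u x = 0" by (simp add: laplacian_eq_trace[OF x] 0)
      moreover note x G
      ultimately show False using super[OF x] by simp
    qed
  qed
qed

section \<open>The arrival time is constant on nearby critical points\<close>

text \<open>
  The derivative vanishes identically.
\<close>
lemma quadratic_modulus_imp_constant:
  fixes g :: "real \<Rightarrow> real"
  assumes g: "\<And>x y. x \<in> {0..1} \<Longrightarrow> y \<in> {0..1} \<Longrightarrow> \<bar>g x - g y\<bar> \<le> C * (x - y)\<^sup>2"
  shows "g 1 = g 0"
proof -
  have "\<exists>c. \<forall>x\<in>{0..1}. g x = c"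
  proof (rule has_field_derivative_zero_constant)
    fix x :: real assume x: "x \<in> {0..1}"
    show "(g has_field_derivative 0) (at x within {0..1})"
      unfolding has_field_derivative_iff
    proof (rule Lim_null_comparison)
      show "((\<lambda>y. C * \<bar>y - x\<bar>) \<longlongrightarrow> 0) (at x within {0..1})"
        by (auto intro!: tendsto_eq_intros)
      show "\<forall>\<^sub>F y in at x within {0..1}. norm ((g y - g x) / (y - x)) \<le> C * \<bar>y - x\<bar>"
      proof (rule eventually_at_topological[THEN iffD2], intro exI[of _ UNIV] conjI ballI impI)
        fix y :: real assume y: "y \<noteq> x" "y \<in> {0..1}"
        with g[OF y(2) x] show "norm ((g y - g x) / (y - x)) \<le> C * \<bar>y - x\<bar>"
          by (simp add: divide_le_eq power2_eq_square flip: abs_mult)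
      qed auto
    qed
  qed simp
  then show ?thesis by (metis atLeastAtMost_iff order_refl zero_le_one)
qed

context C2_arrival begin

text \<open>
  In the proof \<open>\<pi>\<close> is the orthogonal projection to the range of \<open>A\<close>, and \<open>\<Phi>\<close> is the maximal value of
  \<open>u\<close> on the slice \<open>p + t + Y\<close>, where \<open>Y\<close> is a closed ball in the range and \<open>t\<close> is transversal.
\<close>
lemma critical_value_locally_constant:
  assumes p: "p \<in> D" "grad u p = 0"
  obtains \<delta> where "\<delta> > 0" "\<And>z. z \<in> ball p \<delta> \<Longrightarrow> grad u z = 0 \<Longrightarrow> u z = u p"
proof -
  define A where "A = Hess_op u p"
  define \<kappa> where "\<kappa> = laplacian u p + 1"
  have linA: "linear A" unfolding A_def by (rule linear_Hess_op[OF p(1)])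
  have selfA: "A x \<bullet> y = x \<bullet> A y" for x y unfolding A_def by (rule Hess_op_self_adjoint[OF p(1)])
  have sq: "A (A e) = \<kappa> *\<^sub>R A e" for e unfolding A_def \<kappa>_def by (rule Hess_op_square[OF p])
  have neg: "\<kappa> < 0" unfolding \<kappa>_def by (rule laplacian_less[OF p])
  have Hp: "Hess u p v v = v \<bullet> A v" for v unfolding A_def by (simp add: inner_Hess_op[OF p(1)])
  define \<pi> where "\<pi> d = (1 / \<kappa>) *\<^sub>R A d" for d
  have \<pi>1: "A (\<pi> d) = \<kappa> *\<^sub>R \<pi> d" and \<pi>0: "A (d - \<pi> d) = 0" and A\<pi>: "A d = \<kappa> *\<^sub>R \<pi> d" for d
    using neg by (simp_all add: \<pi>_def linear_scale[OF linA] linear_diff[OF linA] sq)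
  have orth: "\<pi> d \<bullet> (d - \<pi> d) = 0" for d
    using selfA[of d "d - \<pi> d"] \<pi>0[of d] by (simp add: \<pi>_def)
  have pyth: "d \<bullet> d = \<pi> d \<bullet> \<pi> d + (d - \<pi> d) \<bullet> (d - \<pi> d)" for d
    using orth[of d] by (simp add: inner_simps inner_commute)
  have norm_\<pi>: "norm (\<pi> d) \<le> norm d" "norm (d - \<pi> d) \<le> norm d" for d
    unfolding norm_le using pyth[of d] by simp_all
  have dAd: "\<kappa> * (d \<bullet> d) \<le> d \<bullet> A d" for d
  proof -
    have "d \<bullet> A d = \<kappa> * (\<pi> d \<bullet> \<pi> d)"
      using orth[of d] unfolding A\<pi> by (simp add: inner_simps inner_commute)
    moreover have "\<pi> d \<bullet> \<pi> d \<le> d \<bullet> d" unfolding pyth[of d] by simp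
    ultimately show ?thesis using neg by (simp add: mult_left_mono_neg)
  qed
  \<comment> \<open>The margin \<open>- \<kappa> / 4\<close> keeps the Hessian below \<open>3 \<kappa> / 4\<close> on the range of \<open>A\<close>, above \<open>\<kappa> / 4\<close> on its
    kernel, and \<open>\<Delta>u + 1\<close> below \<open>3 \<kappa> / 4\<close>.\<close>
  obtain \<rho> where \<rho>: "\<rho> > 0" "ball p \<rho> \<subseteq> D"
    "\<And>q v. q \<in> ball p \<rho> \<Longrightarrow> \<bar>Hess u q v v - Hess u p v v\<bar> \<le> (- \<kappa> / 4) * (v \<bullet> v)"
    "\<And>q. q \<in> ball p \<rho> \<Longrightarrow> \<bar>laplacian u q - laplacian u p\<bar> \<le> - \<kappa> / 4"
    by (rule Hess_uniform_near[OF p(1), of "- \<kappa> / 4"]) (use neg in auto)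
  have critical: "grad u q = 0" if q: "q \<in> ball p \<rho>" and K: "A (grad u q) = 0" for q
  proof -
    let ?G = "grad u q"
    have "(?G \<bullet> ?G) * (laplacian u q + 1) = Hess u q ?G ?G" using pde q \<rho>(2) by blast
    moreover have "Hess u q ?G ?G \<ge> \<kappa> / 4 * (?G \<bullet> ?G)"
      using \<rho>(3)[OF q, of ?G] K by (simp add: Hp)
    moreover have "(?G \<bullet> ?G) * (laplacian u q + 1) \<le> (?G \<bullet> ?G) * (3 * \<kappa> / 4)"
    proof (intro mult_left_mono inner_ge_zero)
      have "laplacian u q = \<kappa> - 1 + (laplacian u q - laplacian u p)" by (simp add: \<kappa>_def)
      with \<rho>(4)[OF q, THEN abs_le_D1] show "laplacian u q + 1 \<le> 3 * \<kappa> / 4" by (simp add: field_simps)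
    qed
    ultimately have "\<kappa> * (?G \<bullet> ?G) \<ge> 0" by (simp add: mult.commute)
    with neg have "?G \<bullet> ?G \<le> 0" by (simp add: zero_le_mult_iff)
    then show ?thesis using inner_ge_zero[of ?G] inner_eq_zero_iff[of ?G] by linarith
  qed
  have upper: "u q' \<le> u q + 3 * \<kappa> / 8 * ((q' - q) \<bullet> (q' - q))"
    if q: "q \<in> ball p \<rho>" "q' \<in> ball p \<rho>" "grad u q = 0" and W: "A (q' - q) = \<kappa> *\<^sub>R (q' - q)" for q q'
  proof -
    obtain \<xi> where \<xi>: "\<xi> \<in> ball p \<rho>" "u q' = u q + grad u q \<bullet> (q' - q) + Hess u \<xi> (q' - q) (q' - q) / 2"
      using second_order_mean_value[OF convex_ball \<rho>(2) q(1,2)] .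
    with \<rho>(3)[OF \<xi>(1), of "q' - q"] q(3) show ?thesis by (simp add: Hp W)
  qed
  have lower: "u q' \<ge> u q + 5 * \<kappa> / 8 * ((q' - q) \<bullet> (q' - q))"
    if q: "q \<in> ball p \<rho>" "q' \<in> ball p \<rho>" "grad u q = 0" for q q'
  proof -
    obtain \<xi> where \<xi>: "\<xi> \<in> ball p \<rho>" "u q' = u q + grad u q \<bullet> (q' - q) + Hess u \<xi> (q' - q) (q' - q) / 2"
      using second_order_mean_value[OF convex_ball \<rho>(2) q(1,2)] .
    with \<rho>(3)[OF \<xi>(1), of "q' - q"] q(3) dAd[of "q' - q"] show ?thesis by (simp add: Hp)
  qed
  \<comment> \<open>The radius and the modulus \<open>\<eta>\<close> are such that a maximiser over \<open>Y\<close> avoids the sphere of radius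
    \<open>r\<close>: on the central slice \<open>u\<close> is at most \<open>u p - 3 \<eta>\<close> there, and moving to the slice of \<open>t\<close>
    changes values by less than \<open>\<eta>\<close>.\<close>
  define r where "r = \<rho> / 3"
  have r: "r > 0" using \<rho>(1) by (simp add: r_def)
  define \<eta> where "\<eta> = - \<kappa> * r\<^sup>2 / 8"
  have \<eta>: "\<eta> > 0" using neg r by (simp add: \<eta>_def mult_neg_pos)
  have dist_eq: "dist p (p + t + y) = norm (t + y)" for t y
    by (metis add.assoc add_diff_cancel_left' dist_commute dist_norm)
  have in_ball: "p + t + y \<in> ball p \<rho>" if "norm t < r" "norm y \<le> r" for t y
  proof -
    have "norm (t + y) < \<rho>" using that norm_triangle_ineq[of t y] \<rho>(1) unfolding r_def by linarith
    then show ?thesis by (simp add: dist_eq)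
  qed
  have cont: "continuous_on (cball p (2 * r)) u"
    using \<rho> differentiable unfolding r_def
    by (intro continuous_at_imp_continuous_on ballI differentiable_imp_continuous_within)
       (auto simp: subset_iff)
  obtain \<delta>' where \<delta>': "\<delta>' > 0"
    "\<And>x y. x \<in> cball p (2 * r) \<Longrightarrow> y \<in> cball p (2 * r) \<Longrightarrow> dist y x < \<delta>' \<Longrightarrow> dist (u y) (u x) < \<eta>"
    using compact_uniformly_continuous[OF cont compact_cball] \<eta>
    unfolding uniformly_continuous_on_def by metis
  define \<delta> where "\<delta> = min \<delta>' r"
  have \<delta>: "\<delta> > 0" "\<delta> \<le> r" "\<delta> \<le> \<delta>'" using \<delta>' r by (auto simp: \<delta>_def)
  define Y where "Y = {y. A y = \<kappa> *\<^sub>R y} \<inter> cball 0 r"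
  have "compact Y"
    unfolding Y_def using linear_continuous_on[OF linA[unfolded linear_conv_bounded_linear], of UNIV]
    by (intro closed_Int_compact compact_cball closed_Collect_eq)
       (auto intro!: continuous_intros)
  have Y0: "0 \<in> Y" using r linear_0[OF linA] by (simp add: Y_def)
  have near: "\<bar>u (p + t + y) - u (p + y)\<bar> < \<eta>" if "norm t < \<delta>" "norm y \<le> r" for t y
  proof -
    have "norm (t + y) \<le> 2 * r" using that norm_triangle_ineq[of t y] \<delta> by linarith
    then show ?thesis
      using \<delta>'(2)[of "p + y" "p + t + y"] that \<delta> r dist_eq[of t y] dist_eq[of 0 y] dist_eq[of t 0, unfolded dist_commute[of p]]
      by (simp add: dist_norm[of "p + t + y"] dist_norm[of "u _"])
  qed
  have "\<exists>y\<in>Y. grad u (p + t + y) = 0 \<and> (\<forall>y'\<in>Y. u (p + t + y') \<le> u (p + t + y))"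
    if t: "norm t < \<delta>" for t
  proof -
    have "continuous_on Y (\<lambda>y. u (p + t + y))"
    proof (rule continuous_on_compose2[OF cont])
      show "(\<lambda>y. p + t + y) ` Y \<subseteq> cball p (2 * r)"
      proof
        fix x assume "x \<in> (\<lambda>y. p + t + y) ` Y"
        then obtain y where y: "x = p + t + y" "norm y \<le> r" by (auto simp: Y_def)
        have "norm (t + y) \<le> 2 * r" using y t norm_triangle_ineq[of t y] \<delta> by linarith
        then show "x \<in> cball p (2 * r)" using y by (simp add: dist_eq)
      qed
    qed (intro continuous_intros)
    then obtain y where y: "y \<in> Y" "\<And>y'. y' \<in> Y \<Longrightarrow> u (p + t + y') \<le> u (p + t + y)"
      using continuous_attains_sup[OF \<open>compact Y\<close>] Y0 by blast
    have yW: "A y = \<kappa> *\<^sub>R y" and yr: "norm y \<le> r" using y(1) by (auto simp: Y_def)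
    have "norm y \<noteq> r"
    proof
      assume eq: "norm y = r"
      have "u (p + y) \<le> u p + 3 * \<kappa> / 8 * r\<^sup>2"
        using upper[of p "p + y"] in_ball[of 0 y] \<rho>(1) p(2) yW eq r by (simp add: power2_norm_eq_inner[symmetric])
      moreover have "u (p + t) \<le> u (p + t + y)" using y(2)[OF Y0] by simp
      moreover note near[OF t, of 0] near[OF t yr] r
      ultimately show False using \<eta> unfolding \<eta>_def by simp
    qed
    with yr have yr: "norm y < r" by simp
    let ?q = "p + t + y"
    have q: "?q \<in> ball p \<rho>" using in_ball t \<delta> yr by simp
    \<comment> \<open>First-order condition at the interior maximum, in all directions of the range of \<open>A\<close>.\<close>
    have "grad u ?q \<bullet> A e = 0" for e
    proof -
      define d where "d = (r - norm y) / (norm (A e) + 1)"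
      have n: "norm (A e) + 1 > 0" by (simp add: add_nonneg_pos)
      have d: "d > 0" unfolding d_def using yr n by simp
      have "((\<lambda>s. u (?q + s *\<^sub>R A e)) has_derivative (\<lambda>s. grad u ?q \<bullet> (s *\<^sub>R A e))) (at 0)"
        by (rule has_derivative_compose[where f="\<lambda>s. ?q + s *\<^sub>R A e"])
           (use has_derivative_grad_inner[of ?q] q \<rho>(2) in \<open>auto intro!: derivative_eq_intros\<close>)
      then have "((\<lambda>s. u (?q + s *\<^sub>R A e)) has_field_derivative (grad u ?q \<bullet> A e)) (at 0)"
        unfolding has_field_derivative_def by (simp add: mult_commute_abs)
      then show ?thesis
      proof (rule DERIV_local_max[OF _ d], intro allI impI)
        fix s assume s: "\<bar>0 - s\<bar> < d"
        have "norm (s *\<^sub>R A e) \<le> \<bar>s\<bar> * (norm (A e) + 1)" by (simp add: mult_left_mono)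
        also have "\<dots> \<le> d * (norm (A e) + 1)" using s n by (intro mult_right_mono) auto
        also have "\<dots> = r - norm y" unfolding d_def using n by simp
        finally have "norm (y + s *\<^sub>R A e) \<le> r" using norm_triangle_ineq[of y "s *\<^sub>R A e"] by linarith
        then have "y + s *\<^sub>R A e \<in> Y"
          by (simp add: Y_def linear_add[OF linA] linear_scale[OF linA] yW sq scaleR_add_right)
        from y(2)[OF this] show "u (?q + s *\<^sub>R A e) \<le> u (?q + 0 *\<^sub>R A e)" by (simp add: add.assoc)
      qed
    qed
    then have "A (grad u ?q) \<bullet> A (grad u ?q) = 0" by (simp add: selfA)
    then have "grad u ?q = 0" using critical[OF q] by simp
    with y show ?thesis by blast
  qed
  then obtain \<psi> where \<psi>: "\<And>t. norm t < \<delta> \<Longrightarrow> \<psi> t \<in> Y"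
    "\<And>t. norm t < \<delta> \<Longrightarrow> grad u (p + t + \<psi> t) = 0"
    "\<And>t y. norm t < \<delta> \<Longrightarrow> y \<in> Y \<Longrightarrow> u (p + t + y) \<le> u (p + t + \<psi> t)"
    by metis
  define \<Phi> where "\<Phi> t = u (p + t + \<psi> t)" for t
  \<comment> \<open>Compare with the translate, by \<open>t' - t\<close>, of the maximiser on the slice of \<open>t\<close>, a critical point.\<close>
  have step: "\<Phi> t + 5 * \<kappa> / 8 * ((t' - t) \<bullet> (t' - t)) \<le> \<Phi> t'" if t: "norm t < \<delta>" "norm t' < \<delta>" for t t'
  proof -
    have "norm (\<psi> t) \<le> r" using \<psi>(1)[OF t(1)] by (simp add: Y_def)
    then have "\<Phi> t + 5 * \<kappa> / 8 * ((t' - t) \<bullet> (t' - t)) \<le> u (p + t' + \<psi> t)"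
      using lower[of "p + t + \<psi> t" "p + t' + \<psi> t"] \<psi>(2)[OF t(1)] in_ball t \<delta>(2) by (simp add: \<Phi>_def)
    also have "\<dots> \<le> \<Phi> t'" unfolding \<Phi>_def using \<psi>(3)[OF t(2) \<psi>(1)[OF t(1)]] .
    finally show ?thesis .
  qed
  have const: "\<Phi> t = \<Phi> 0" if t: "norm t < \<delta>" for t
  proof -
    have "\<Phi> (1 *\<^sub>R t) = \<Phi> (0 *\<^sub>R t)"
    proof (rule quadratic_modulus_imp_constant[where C="- 5 * \<kappa> / 8 * (t \<bullet> t)"])
      have *: "norm (x *\<^sub>R t) < \<delta>" if "x \<in> {0..1}" for x
        using t that by (auto intro: le_less_trans[OF mult_left_le_one_le])
      fix x y :: real assume xy: "x \<in> {0..1}" "y \<in> {0..1}"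
      have "(x *\<^sub>R t - y *\<^sub>R t) \<bullet> (x *\<^sub>R t - y *\<^sub>R t) = (t \<bullet> t) * (x - y)\<^sup>2"
           "(y *\<^sub>R t - x *\<^sub>R t) \<bullet> (y *\<^sub>R t - x *\<^sub>R t) = (t \<bullet> t) * (x - y)\<^sup>2"
        by (simp_all add: power2_eq_square algebra_simps flip: scaleR_diff_left)
      then show "\<bar>\<Phi> (x *\<^sub>R t) - \<Phi> (y *\<^sub>R t)\<bar> \<le> - 5 * \<kappa> / 8 * (t \<bullet> t) * (x - y)\<^sup>2"
        using step[OF *[OF xy(1)] *[OF xy(2)]] step[OF *[OF xy(2)] *[OF xy(1)]] by simp
    qed
    then show ?thesis by simp
  qed
  have val: "u z = \<Phi> 0" if z: "z \<in> ball p \<delta>" "grad u z = 0" for z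
  proof -
    define y where "y = \<pi> (z - p)"
    define t where "t = (z - p) - y"
    have "norm (z - p) < \<delta>" using z by (simp add: dist_norm norm_minus_commute)
    then have ty: "norm t < \<delta>" "norm y \<le> r" unfolding t_def y_def using norm_\<pi>[of "z - p"] \<delta> by linarith+
    have zeq: "z = p + t + y" by (simp add: t_def)
    have yY: "y \<in> Y" using ty \<pi>1 by (simp add: Y_def y_def)
    have W: "A (\<psi> t) = \<kappa> *\<^sub>R \<psi> t" "norm (\<psi> t) \<le> r" "A y = \<kappa> *\<^sub>R y"
      using \<psi>(1)[OF ty(1)] yY by (auto simp: Y_def)
    have "u (p + t + \<psi> t) \<le> u z + 3 * \<kappa> / 8 * ((\<psi> t - y) \<bullet> (\<psi> t - y))"
      using upper[of z "p + t + \<psi> t"] in_ball[of t] ty \<delta>(2) z(2) W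
      by (simp add: zeq linear_diff[OF linA] scaleR_diff_right)
    also have "\<dots> \<le> u z" using neg by (simp add: mult_le_0_iff)
    finally have "u z = \<Phi> t" using \<psi>(3)[OF ty(1) yY] unfolding \<Phi>_def zeq by simp
    with const[OF ty(1)] show ?thesis by simp
  qed
  show ?thesis
    by (rule that[OF \<delta>(1)]) (use val val[of p] p(2) \<delta>(1) in auto)
qed

end

section \<open>Critical points do not accumulate at the boundary\<close>

text \<open>
  A tangent vector is a limit of secant directions: for small \<open>s > 0\<close> the function \<open>\<phi>\<close> changes sign
  between \<open>p + s (\<tau> - \<epsilon> \<nabla>\<phi>(p))\<close> and \<open>p + s (\<tau> + \<epsilon> \<nabla>\<phi>(p))\<close>, and vanishes somewhere in between.
\<close>
lemma level_set_tangent_sequence: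
  fixes \<phi> :: "'a::euclidean_space \<Rightarrow> real"
  assumes U: "open U" "p \<in> U" and cont: "continuous_on U \<phi>" and diff: "\<phi> differentiable (at p)"
    and p: "\<phi> p = 0" and tangent: "grad \<phi> p \<bullet> \<tau> = 0" and n: "grad \<phi> p \<noteq> 0"
  obtains s d where "\<And>k. s k > 0" "s \<longlonglongrightarrow> 0" "d \<longlonglongrightarrow> \<tau>"
    "\<And>k::nat. p + s k *\<^sub>R d k \<in> U" "\<And>k. \<phi> (p + s k *\<^sub>R d k) = 0"
proof -
  let ?n = "grad \<phi> p"
  obtain R where R: "R > 0" "ball p R \<subseteq> U" using U openE by blast
  have ex: "\<exists>s d. 0 < s \<and> s < \<epsilon> \<and> norm (d - \<tau>) \<le> \<epsilon> * norm ?n \<and> p + s *\<^sub>R d \<in> U \<and> \<phi> (p + s *\<^sub>R d) = 0"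
    if \<epsilon>: "\<epsilon> > 0" for \<epsilon>
  proof -
    have der: "((\<lambda>s. \<phi> (p + s *\<^sub>R (\<tau> + \<sigma> *\<^sub>R ?n))) has_field_derivative (\<sigma> * (?n \<bullet> ?n))) (at 0)" for \<sigma>
    proof -
      have "(\<phi> has_derivative (\<lambda>v. ?n \<bullet> v)) (at p)"
        using diff frechet_derivative_works frechet_derivative_eq_grad[OF diff] by (metis ext)
      then have 1: "(\<phi> has_derivative (\<lambda>v. ?n \<bullet> v)) (at (p + 0 *\<^sub>R (\<tau> + \<sigma> *\<^sub>R ?n)))" by simp
      have "((\<lambda>s. p + s *\<^sub>R (\<tau> + \<sigma> *\<^sub>R ?n)) has_derivative (\<lambda>s. s *\<^sub>R (\<tau> + \<sigma> *\<^sub>R ?n))) (at 0)"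
        by (auto intro!: derivative_eq_intros)
      from has_derivative_compose[OF this 1]
      have "((\<lambda>s. \<phi> (p + s *\<^sub>R (\<tau> + \<sigma> *\<^sub>R ?n))) has_derivative
          (\<lambda>s. ?n \<bullet> (s *\<^sub>R (\<tau> + \<sigma> *\<^sub>R ?n)))) (at 0)" .
      then show ?thesis
        unfolding has_field_derivative_def by (simp add: inner_add_right tangent mult_commute_abs)
    qed
    have nn: "?n \<bullet> ?n > 0" using n by simp
    obtain d1 where d1: "d1 > 0" "\<And>h. 0 < h \<Longrightarrow> h < d1 \<Longrightarrow> 0 < \<phi> (p + h *\<^sub>R (\<tau> + \<epsilon> *\<^sub>R ?n))"
      using DERIV_pos_inc_right[OF der[of \<epsilon>]] nn \<epsilon> p by (auto simp: zero_less_mult_iff)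
    obtain d2 where d2: "d2 > 0" "\<And>h. 0 < h \<Longrightarrow> h < d2 \<Longrightarrow> \<phi> (p + h *\<^sub>R (\<tau> + (-\<epsilon>) *\<^sub>R ?n)) < 0"
      using DERIV_neg_dec_right[OF der[of "-\<epsilon>"]] nn \<epsilon> p by (auto simp: mult_less_0_iff)
    define L where "L = norm \<tau> + \<epsilon> * norm ?n + 1"
    have L: "L > 0" unfolding L_def using \<epsilon> by (simp add: add_nonneg_pos)
    define m where "m = min (min d1 d2) (min \<epsilon> (R / L))"
    define s where "s = m / 2"
    have "0 < m" "m \<le> d1" "m \<le> d2" "m \<le> \<epsilon>" "m \<le> R / L" using d1 d2 \<epsilon> R L by (auto simp: m_def)
    then have s: "s > 0" "s < d1" "s < d2" "s < \<epsilon>" "s < R / L" unfolding s_def by linarith+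
    have inU: "p + s *\<^sub>R (\<tau> + \<sigma> *\<^sub>R ?n) \<in> U" if "\<bar>\<sigma>\<bar> \<le> \<epsilon>" for \<sigma>
    proof -
      have "norm (\<tau> + \<sigma> *\<^sub>R ?n) \<le> norm \<tau> + \<bar>\<sigma>\<bar> * norm ?n" using norm_triangle_ineq by (metis norm_scaleR)
      also have "\<dots> \<le> L" unfolding L_def using that mult_right_mono[OF that, of "norm ?n"] by simp
      finally have "s * norm (\<tau> + \<sigma> *\<^sub>R ?n) \<le> s * L" using s(1) by (intro mult_left_mono) auto
      also have "\<dots> < R" using s(5) L by (simp add: field_simps)
      finally have "dist (p + s *\<^sub>R (\<tau> + \<sigma> *\<^sub>R ?n)) p < R" using s(1) by (simp add: dist_norm)
      then show ?thesis using R(2) by (auto simp: dist_commute)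
    qed
    have "\<exists>\<sigma>\<ge>-\<epsilon>. \<sigma> \<le> \<epsilon> \<and> \<phi> (p + s *\<^sub>R (\<tau> + \<sigma> *\<^sub>R ?n)) = 0"
    proof (rule IVT')
      show "\<phi> (p + s *\<^sub>R (\<tau> + (-\<epsilon>) *\<^sub>R ?n)) \<le> 0" using d2(2)[OF s(1,3)] by simp
      show "0 \<le> \<phi> (p + s *\<^sub>R (\<tau> + \<epsilon> *\<^sub>R ?n))" using d1(2)[OF s(1,2)] by simp
      show "continuous_on {-\<epsilon>..\<epsilon>} (\<lambda>\<sigma>. \<phi> (p + s *\<^sub>R (\<tau> + \<sigma> *\<^sub>R ?n)))"
        by (rule continuous_on_compose2[OF cont]) (use inU in \<open>auto intro!: continuous_intros\<close>)
    qed (use \<epsilon> in simp)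
    then obtain \<sigma> where "-\<epsilon> \<le> \<sigma>" "\<sigma> \<le> \<epsilon>" and \<sigma>0: "\<phi> (p + s *\<^sub>R (\<tau> + \<sigma> *\<^sub>R ?n)) = 0" by blast
    then have \<sigma>: "\<bar>\<sigma>\<bar> \<le> \<epsilon>" by linarith
    show ?thesis
      by (rule exI[of _ s], rule exI[of _ "\<tau> + \<sigma> *\<^sub>R ?n"]) (use s inU \<sigma> \<sigma>0 in \<open>auto intro: mult_right_mono\<close>)
  qed
  have "\<forall>k. \<exists>s d. 0 < s \<and> s < 1 / real (Suc k) \<and> norm (d - \<tau>) \<le> 1 / real (Suc k) * norm ?n \<and>
      p + s *\<^sub>R d \<in> U \<and> \<phi> (p + s *\<^sub>R d) = 0"
    by (intro allI ex) simp
  then obtain s d where sd: "\<And>k. 0 < s k \<and> s k < 1 / real (Suc k) \<and>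
      norm (d k - \<tau>) \<le> 1 / real (Suc k) * norm ?n \<and> p + s k *\<^sub>R d k \<in> U \<and> \<phi> (p + s k *\<^sub>R d k) = 0"
    by metis
  show ?thesis
  proof (rule that[of s d])
    have lim: "(\<lambda>k. 1 / real (Suc k)) \<longlonglongrightarrow> 0"
      using LIMSEQ_inverse_real_of_nat by (simp add: inverse_eq_divide)
    show "s \<longlonglongrightarrow> 0"
      by (rule Lim_null_comparison[OF always_eventually lim]) (use sd in \<open>auto intro: less_imp_le simp: less_imp_le\<close>)
    have "(\<lambda>k. d k - \<tau>) \<longlonglongrightarrow> 0"
      by (rule Lim_null_comparison[OF always_eventually tendsto_mult_left_zero[OF lim]]) (use sd in blast)
    then show "d \<longlonglongrightarrow> \<tau>" using LIM_zero_cancel by blast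
  qed (use sd in auto)
qed

text \<open>
  At a critical point the second-order expansion along secants to \<open>M\<close> consists of the Hessian term
  alone, while \<open>g\<close> vanishes at both ends.
\<close>
lemma tangential_Hess_zero:
  assumes C2: "C2_function D g" and p: "p \<in> D" "g p = 0" "grad g p = 0"
    and M: "smooth_hypersurface M" "p \<in> M" and zero: "\<And>y. y \<in> M \<inter> D \<Longrightarrow> g y = 0"
  obtains n where "norm n = 1" "\<And>\<tau>. n \<bullet> \<tau> = 0 \<Longrightarrow> Hess g p \<tau> \<tau> = 0"
proof -
  interpret C2_function D g by fact
  obtain U \<phi> where "open U \<and> p \<in> U \<and> smooth_on U (\<phi> :: 'a \<Rightarrow> real) \<and>
      (\<forall>y\<in>U. grad \<phi> y \<noteq> 0) \<and> M \<inter> U = {y\<in>U. \<phi> y = 0}"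
    using M(1)[unfolded smooth_hypersurface_def, rule_format, OF M(2)] by (elim exE)
  then have U: "open U" "p \<in> U" and sm: "smooth_on U \<phi>"
    and n: "\<And>y. y \<in> U \<Longrightarrow> grad \<phi> y \<noteq> 0" and MU: "M \<inter> U = {y\<in>U. \<phi> y = 0}"
    by simp_all
  have cont: "continuous_on U \<phi>" and diff: "\<phi> differentiable (at p)"
    using sm[unfolded smooth_on_def, THEN spec, of 0] sm[unfolded smooth_on_def, THEN spec, of "Suc 0"] U by auto
  obtain R where R: "R > 0" "ball p R \<subseteq> D" using p open_domain openE by blast
  have "Hess g p \<tau> \<tau> = 0" if \<tau>: "grad \<phi> p \<bullet> \<tau> = 0" for \<tau>
  proof -
    obtain s d where sd: "\<And>k. s k > 0" "s \<longlonglongrightarrow> 0" "d \<longlonglongrightarrow> \<tau>"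
      "\<And>k::nat. p + s k *\<^sub>R d k \<in> U" "\<And>k. \<phi> (p + s k *\<^sub>R d k) = 0"
      by (rule level_set_tangent_sequence[OF U cont diff _ \<tau> n[OF U(2)]]) (use MU M U in auto)
    have lim: "(\<lambda>k. p + s k *\<^sub>R d k) \<longlonglongrightarrow> p"
      using tendsto_add[OF tendsto_const tendsto_scaleR[OF sd(2,3)], of p] by simp
    have "\<forall>\<^sub>F k in sequentially. p + s k *\<^sub>R d k \<in> ball p R"
      using topological_tendstoD[OF lim open_ball] R(1) by simp
    then have ev: "\<forall>\<^sub>F k in sequentially. \<exists>\<xi>. dist p \<xi> \<le> dist p (p + s k *\<^sub>R d k) \<and> \<xi> \<in> D \<and> Hess g \<xi> (d k) (d k) = 0"
    proof eventually_elim
      case (elim k)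
      let ?q = "p + s k *\<^sub>R d k"
      have "?q \<in> M \<inter> D" using MU sd(4,5)[of k] R(2) elim by auto
      then have gq: "g ?q = 0" by (rule zero)
      have sub: "closed_segment p ?q \<subseteq> ball p R"
        using elim R(1) by (intro closed_segment_subset convex_ball) auto
      obtain \<xi> where \<xi>: "\<xi> \<in> closed_segment p ?q"
        "g ?q = g p + grad g p \<bullet> (?q - p) + Hess g \<xi> (?q - p) (?q - p) / 2"
        using second_order_mean_value[OF convex_closed_segment _ ends_in_segment, of p ?q] sub R(2) by blast
      have \<xi>D: "\<xi> \<in> D" using \<xi>(1) sub R(2) by blast
      have "s k * (s k * Hess g \<xi> (d k) (d k)) = 0"
        using \<xi>(2) gq p by (simp add: linear_scale[OF linear_Hess_left[OF \<xi>D]] linear_scale[OF linear_Hess_right[OF \<xi>D]])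
      then have "Hess g \<xi> (d k) (d k) = 0" using sd(1)[of k] by simp
      moreover have "dist p \<xi> \<le> dist p ?q" using \<xi>(1) dist_in_closed_segment by (metis dist_commute)
      ultimately show ?case using \<xi>D by blast
    qed
    define \<xi> where "\<xi> k = (SOME \<xi>. dist p \<xi> \<le> dist p (p + s k *\<^sub>R d k) \<and> \<xi> \<in> D \<and> Hess g \<xi> (d k) (d k) = 0)" for k
    have ev\<xi>: "\<forall>\<^sub>F k in sequentially. dist p (\<xi> k) \<le> dist p (p + s k *\<^sub>R d k) \<and> \<xi> k \<in> D \<and> Hess g (\<xi> k) (d k) (d k) = 0"
      using ev by eventually_elim (unfold \<xi>_def, rule someI_ex)
    have "(\<lambda>k. dist p (p + s k *\<^sub>R d k)) \<longlonglongrightarrow> 0"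
      using tendsto_dist[OF tendsto_const lim, of p] by simp
    then have "(\<lambda>k. dist (\<xi> k) p) \<longlonglongrightarrow> 0"
      by (rule Lim_null_comparison[rotated]) (use ev\<xi> in \<open>auto elim!: eventually_mono simp: dist_commute\<close>)
    then have "\<xi> \<longlonglongrightarrow> p" by (rule tendsto_dist_iff[THEN iffD2])
    from tendsto_Hess[OF this p(1) sd(3) sd(3)]
    have "(\<lambda>k. Hess g (\<xi> k) (d k) (d k)) \<longlonglongrightarrow> Hess g p \<tau> \<tau>" .
    moreover have "(\<lambda>k. Hess g (\<xi> k) (d k) (d k)) \<longlonglongrightarrow> 0"
      by (rule tendsto_eventually) (use ev\<xi> in \<open>auto elim!: eventually_mono\<close>)
    ultimately show ?thesis using LIMSEQ_unique by blast
  qed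
  then show ?thesis
    by (intro that[of "sgn (grad \<phi> p)"]) (use n[OF U(2)] in \<open>auto simp: norm_sgn sgn_div_norm\<close>)
qed

text \<open>
  The relations between \<open>A\<close> and \<open>\<kappa>\<close> at interior critical points are closed conditions, so they would
  hold at a boundary limit point for the analytic extension \<open>g\<close> of \<open>u\<close>.  There the trace of \<open>A\<close> is
  \<open>\<mu> = \<langle>n, A n\<rangle>\<close>, as \<open>A\<close> annihilates the tangent vectors by \<open>\<bar>A \<tau>\<bar>\<^sup>2 = \<kappa> \<langle>A \<tau>, \<tau>\<rangle> = 0\<close>; Cauchy's inequality \<open>\<mu>\<^sup>2 \<le> \<bar>A n\<bar>\<^sup>2 = \<kappa> \<mu>\<close> with
  \<open>\<mu> = \<kappa> - 1\<close> gives \<open>\<kappa> \<ge> 1\<close>.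
\<close>
lemma no_critical_points_near_boundary:
  assumes M: "smooth_hypersurface (frontier \<Omega>)" and \<Omega>: "closed \<Omega>"
    and u0: "\<And>x. x \<in> frontier \<Omega> \<Longrightarrow> u x = 0"
    and visc: "viscosity_solution (interior \<Omega>) u" and an: "real_analytic_on \<Omega> u"
    and p: "p \<in> frontier \<Omega>"
  obtains \<epsilon> where "\<epsilon> > 0" "\<And>z. z \<in> interior \<Omega> \<inter> ball p \<epsilon> \<Longrightarrow> grad u z \<noteq> 0"
proof (rule ccontr)
  assume no: "\<not> thesis"
  interpret U: C2_arrival "interior \<Omega>" u
    by (rule arrival_equation(1)[OF visc analytic_smooth_on_interior[OF an] analytic_C2_interior[OF an]])
  have fr: "frontier \<Omega> \<subseteq> \<Omega>" using \<Omega> by (rule frontier_subset_closed)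
  obtain r c g where r: "r > 0" "has_power_series p r c g" "\<And>x. x \<in> \<Omega> \<inter> ball p r \<Longrightarrow> u x = g x"
    by (rule real_analytic_on_power_series[OF an]) (use p fr in auto)
  interpret G: C2_function "ball p r" g by (rule has_power_series_C2_function[OF r(2)])
  have pr: "p \<in> ball p r" using r(1) by simp
  define S where "S = {z \<in> interior \<Omega> \<inter> ball p r. grad u z = 0}"
  have "p islimpt S"
    unfolding islimpt_approachable
  proof (intro allI impI)
    fix e :: real assume "e > 0"
    have "\<not> (\<forall>z\<in>interior \<Omega> \<inter> ball p (min e r). grad u z \<noteq> 0)"
    proof (rule contrapos_nn[OF no])
      assume "\<forall>z\<in>interior \<Omega> \<inter> ball p (min e r). grad u z \<noteq> 0"
      then show thesis by (intro that[of "min e r"]) (use r(1) \<open>e > 0\<close> in auto)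
    qed
    then obtain z where z: "z \<in> interior \<Omega>" "dist p z < min e r" "grad u z = 0" by auto
    moreover have "z \<noteq> p" using p z(1) by (auto simp: frontier_def)
    ultimately show "\<exists>z\<in>S. z \<noteq> p \<and> dist z p < e" by (auto simp: S_def dist_commute)
  qed
  then have nt: "at p within S \<noteq> bot" by (simp add: trivial_limit_within)
  let ?A = "Hess_op g p" and ?\<kappa> = "laplacian g p + 1"
  have id: "((\<lambda>z. z) \<longlongrightarrow> p) (at p within S)" by (rule tendsto_ident_at)
  have S: "grad g z = 0 \<and> laplacian g z + 1 < 0 \<and> (\<forall>e. Hess_op g z (Hess_op g z e) = (laplacian g z + 1) *\<^sub>R Hess_op g z e)"
    if "z \<in> S" for z
  proof -
    have z: "z \<in> interior \<Omega> \<inter> ball p r" "grad u z = 0" using that by (auto simp: S_def)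
    have eqs: "y \<in> interior \<Omega> \<inter> ball p r \<Longrightarrow> g y = u y" for y using r(3) interior_subset by force
    have op: "open (interior \<Omega> \<inter> ball p r)" by auto
    have 1: "grad g z = grad u z" "Hess g z = Hess u z"
      using U.cong(2,3)[OF op Int_lower1 eqs z(1)] by auto
    then have 2: "Hess_op g z = Hess_op u z" "laplacian g z = laplacian u z"
      by (simp_all add: Hess_op_def laplacian_def fun_eq_iff)
    show ?thesis unfolding 1 2 using z U.Hess_op_square U.laplacian_less by auto
  qed
  have ev: "\<forall>\<^sub>F z in at p within S. z \<in> S" by (simp add: eventually_at_filter)
  have "((\<lambda>z. grad g z) \<longlongrightarrow> grad g p) (at p within S)" by (rule G.tendsto_grad[OF id pr])
  moreover have "((\<lambda>z. grad g z) \<longlongrightarrow> 0) (at p within S)"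
    by (rule tendsto_eventually) (use S ev in \<open>auto elim!: eventually_mono\<close>)
  ultimately have gp: "grad g p = 0" using tendsto_unique[OF nt] by blast
  have "((\<lambda>z. laplacian g z + 1) \<longlongrightarrow> ?\<kappa>) (at p within S)"
    by (intro tendsto_intros G.tendsto_laplacian[OF id pr])
  then have neg: "?\<kappa> \<le> 0"
    by (rule tendsto_upperbound[OF _ _ nt]) (use S ev in \<open>auto elim!: eventually_mono simp: less_imp_le\<close>)
  have sq: "?A (?A e) = ?\<kappa> *\<^sub>R ?A e" for e
  proof (rule tendsto_unique[OF nt])
    show "((\<lambda>z. Hess_op g z (Hess_op g z e)) \<longlongrightarrow> ?A (?A e)) (at p within S)"
      by (intro G.tendsto_Hess_op[OF id pr] tendsto_const)
    have "((\<lambda>z. (laplacian g z + 1) *\<^sub>R Hess_op g z e) \<longlongrightarrow> ?\<kappa> *\<^sub>R ?A e) (at p within S)"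
      by (intro tendsto_intros G.tendsto_Hess_op[OF id pr] G.tendsto_laplacian[OF id pr])
    then show "((\<lambda>z. Hess_op g z (Hess_op g z e)) \<longlongrightarrow> ?\<kappa> *\<^sub>R ?A e) (at p within S)"
      by (rule Lim_transform_eventually) (use S ev in \<open>auto elim!: eventually_mono\<close>)
  qed
  have self: "?A x \<bullet> y = x \<bullet> ?A y" for x y by (rule G.Hess_op_self_adjoint[OF pr])
  have zero: "g y = 0" if "y \<in> frontier \<Omega> \<inter> ball p r" for y
    using r(3)[of y] u0[of y] that fr by auto
  have gp0: "g p = 0" using zero[of p] p pr by blast
  obtain n where n: "norm n = 1" "\<And>\<tau>. n \<bullet> \<tau> = 0 \<Longrightarrow> Hess g p \<tau> \<tau> = 0"
    by (rule tangential_Hess_zero[OF G.C2_function_axioms pr gp0 gp M p zero], assumption, rule that, auto)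
  have ker: "?A \<tau> = 0" if "n \<bullet> \<tau> = 0" for \<tau>
  proof -
    have "?A \<tau> \<bullet> ?A \<tau> = ?\<kappa> * (\<tau> \<bullet> ?A \<tau>)" by (simp add: self sq)
    also have "\<dots> = 0" using n(2)[OF that] by (simp add: G.inner_Hess_op[OF pr])
    finally show ?thesis by simp
  qed
  define \<mu> where "\<mu> = n \<bullet> ?A n"
  have nn: "n \<bullet> n = 1" using n(1) by (simp add: dot_square_norm)
  have An: "?A v = (n \<bullet> v) *\<^sub>R ?A n" for v
  proof -
    have "n \<bullet> (v - (n \<bullet> v) *\<^sub>R n) = 0" by (simp add: inner_simps nn)
    from ker[OF this] show ?thesis
      by (simp add: linear_diff[OF G.linear_Hess_op[OF pr]] linear_scale[OF G.linear_Hess_op[OF pr]])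
  qed
  have "laplacian g p = (\<Sum>b\<in>Basis. (n \<bullet> b) * (?A n \<bullet> b))"
    unfolding G.laplacian_eq_trace[OF pr] by (subst An) simp
  also have "\<dots> = \<mu>" unfolding \<mu>_def by (rule euclidean_inner[symmetric])
  finally have tr: "\<mu> = ?\<kappa> - 1" by simp
  have "\<mu>\<^sup>2 \<le> (n \<bullet> n) * (?A n \<bullet> ?A n)" unfolding \<mu>_def by (rule Cauchy_Schwarz_ineq)
  also have "\<dots> = ?\<kappa> * \<mu>" by (simp add: nn self sq \<mu>_def)
  finally have "(?\<kappa> - 1)\<^sup>2 \<le> ?\<kappa> * (?\<kappa> - 1)" unfolding tr .
  then have "1 \<le> ?\<kappa>" by (simp add: power2_eq_square algebra_simps)
  with neg show False by simp
qed

section \<open>Singular times\<close>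

text \<open>
  The function \<open>u (y) - s\<close> has time derivative \<open>-1\<close>, so moving by mean curvature means that the mean
  curvature of its level sets is \<open>-1 / \<bar>\<nabla>u\<bar>\<close>: this is the arrival time equation divided by \<open>\<bar>\<nabla>u\<bar>\<close>.
\<close>
lemma regular_point_interior:
  assumes visc: "viscosity_solution (interior \<Omega>) u" and an: "real_analytic_on \<Omega> u"
    and x: "x \<in> interior \<Omega>" and G: "grad u x \<noteq> 0"
  shows "regular_point \<Omega> u x"
proof -
  let ?D = "interior \<Omega>"
  interpret C2_function ?D u by (rule analytic_C2_interior[OF an])
  have smooth: "smooth_on ?D u" by (rule analytic_smooth_on_interior[OF an])
  note eq = arrival_equation(2)[OF visc smooth analytic_C2_interior[OF an]]
  have "\<forall>\<^sub>F y in nhds x. grad u y \<noteq> 0"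
    using tendsto_imp_eventually_ne[OF tendsto_grad[OF filterlim_ident x] G] .
  moreover have "\<forall>\<^sub>F y in nhds x. y \<in> ?D" using x by (intro eventually_nhds_in_open) auto
  ultimately have "\<forall>\<^sub>F y in nhds x. grad u y \<noteq> 0 \<and> y \<in> ?D" by (rule eventually_conj)
  then obtain U where U: "open U" "x \<in> U" "\<And>y. y \<in> U \<Longrightarrow> grad u y \<noteq> 0" "U \<subseteq> ?D"
    unfolding eventually_nhds by blast
  have U\<Omega>: "U \<subseteq> \<Omega>" using U(4) interior_subset by blast
  define I where "I = {u x - 1 <..< u x + 1}"
  define \<Phi> where "\<Phi> z = u (fst z) + (-1) * snd z + 0" for z
  have "Ck_on k U u" for k
    by (rule Ck_on_glue) (use smooth U x in \<open>auto simp: smooth_on_def intro!: exI[of _ ?D]\<close>)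
  then have "smooth_on (U \<times> I) \<Phi>"
    unfolding smooth_on_def \<Phi>_def I_def
    by (intro allI Ck_on_affine_in_second[OF U(1), where f=u]) auto
  moreover have "level_set_flow \<Omega> u s \<inter> U = {y \<in> U. \<Phi> (y, s) = 0}" for s
    using U\<Omega> by (auto simp: level_set_flow_def \<Phi>_def)
  moreover have "grad (\<lambda>z. \<Phi> (z, s)) y \<noteq> 0 \<and>
      - deriv (\<lambda>r. \<Phi> (y, r)) s / norm (grad (\<lambda>z. \<Phi> (z, s)) y)
        = - mean_curvature (unit_grad (\<lambda>z. \<Phi> (z, s))) y" if y: "y \<in> U" for y s
  proof -
    have grad_eq: "grad (\<lambda>z. \<Phi> (z, s)) z = grad u z" if z: "z \<in> U" for z
    proof -
      have "(u has_derivative frechet_derivative u (at z)) (at z)"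
        using differentiable[of z] z U(4) frechet_derivative_works by blast
      then have "((\<lambda>z. \<Phi> (z, s)) has_derivative frechet_derivative u (at z)) (at z)"
        unfolding \<Phi>_def by (auto intro!: derivative_eq_intros)
      from frechet_derivative_at[OF this] show ?thesis unfolding grad_def by simp
    qed
    have "((\<lambda>r. \<Phi> (y, r)) has_field_derivative -1) (at s)"
      unfolding \<Phi>_def by (auto intro!: derivative_eq_intros)
    then have "deriv (\<lambda>r. \<Phi> (y, r)) s = -1" by (rule DERIV_imp_deriv)
    moreover have "mean_curvature (unit_grad (\<lambda>z. \<Phi> (z, s))) y = -1 / norm (grad u y)"
      using mean_curvature_unit_grad[of y U "unit_grad (\<lambda>z. \<Phi> (z, s))"] eq[of y] U y grad_eq
      by (auto simp: unit_grad_def)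
    ultimately show ?thesis using grad_eq[OF y] U(3)[OF y] by simp
  qed
  ultimately have "smooth_mcf_in (level_set_flow \<Omega> u) U I"
    unfolding smooth_mcf_in_def by blast
  then show ?thesis
    unfolding regular_point_def I_def using U U\<Omega> x interior_subset by (meson subsetD zero_less_one)
qed

theorem corollary1p6:
  fixes M0 \<Omega>0 :: "'a::euclidean_space set" and u :: "'a \<Rightarrow> real"
  assumes "closed_smooth_hypersurface M0"
    and "bounds_compact_domain M0 \<Omega>0"
    and "mean_convex_boundary \<Omega>0"
    and "is_arrival_time \<Omega>0 u"
    and "real_analytic_on \<Omega>0 u"
  shows "finite {t. singular_time \<Omega>0 u t}"
proof -
  have \<Omega>: "compact \<Omega>0" and M0: "M0 = frontier \<Omega>0"
    using assms(2) by (auto simp: bounds_compact_domain_def)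
  then have cl: "closed \<Omega>0" by (simp add: compact_imp_closed)
  have M: "smooth_hypersurface (frontier \<Omega>0)"
    using assms(1) M0 by (simp add: closed_smooth_hypersurface_def)
  have u0: "u x = 0" if "x \<in> frontier \<Omega>0" for x
    using assms(4) that by (simp add: is_arrival_time_def)
  have visc: "viscosity_solution (interior \<Omega>0) u"
    using assms(4) by (simp add: is_arrival_time_def)
  interpret C2_arrival "interior \<Omega>0" u
    by (rule arrival_equation(1)[OF visc analytic_smooth_on_interior[OF assms(5)]
        analytic_C2_interior[OF assms(5)]])
  define S where "S = {z \<in> interior \<Omega>0. grad u z = 0}"
  have "\<exists>\<epsilon>>0. \<forall>z\<in>S \<inter> ball p \<epsilon>. u z = u p" if p: "p \<in> \<Omega>0" for p
  proof (cases "p \<in> interior \<Omega>0")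
    case False
    then have "p \<in> frontier \<Omega>0" using p closure_subset by (auto simp: frontier_def)
    from no_critical_points_near_boundary[OF M cl u0 visc assms(5) this]
    obtain \<epsilon> where "\<epsilon> > 0" "\<And>z. z \<in> interior \<Omega>0 \<inter> ball p \<epsilon> \<Longrightarrow> grad u z \<noteq> 0" by blast
    then show ?thesis by (auto simp: S_def)
  next
    case int: True
    show ?thesis
    proof (cases "grad u p = 0")
      case True
      obtain \<delta> where "\<delta> > 0" "\<And>z. z \<in> ball p \<delta> \<Longrightarrow> grad u z = 0 \<Longrightarrow> u z = u p"
        by (rule critical_value_locally_constant[OF int True]) blast
      then show ?thesis by (auto simp: S_def)
    next
      case False
      have "\<forall>\<^sub>F y in nhds p. grad u y \<noteq> 0"
        by (rule tendsto_imp_eventually_ne[OF tendsto_grad[OF filterlim_ident int] False])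
      then show ?thesis unfolding eventually_nhds_metric by (auto simp: S_def dist_commute)
    qed
  qed
  then obtain \<epsilon> where \<epsilon>: "\<And>p. p \<in> \<Omega>0 \<Longrightarrow> \<epsilon> p > 0" "\<And>p z. p \<in> \<Omega>0 \<Longrightarrow> z \<in> S \<inter> ball p (\<epsilon> p) \<Longrightarrow> u z = u p"
    by metis
  obtain K where K: "K \<subseteq> \<Omega>0" "finite K" "\<Omega>0 \<subseteq> (\<Union>p\<in>K. ball p (\<epsilon> p))"
    by (rule compactE_image[OF \<Omega>, of \<Omega>0 "\<lambda>p. ball p (\<epsilon> p)"]) (use \<epsilon>(1) in auto)
  have "t \<in> insert 0 (u ` K)" if t: "singular_time \<Omega>0 u t" for t
  proof -
    obtain x where x: "x \<in> \<Omega>0" "u x = t" "\<not> regular_point \<Omega>0 u x"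
      using t by (auto simp: singular_time_def level_set_flow_def singular_point_def)
    show ?thesis
    proof (cases "x \<in> interior \<Omega>0")
      case False
      then show ?thesis using x u0[of x] closure_subset by (auto simp: frontier_def)
    next
      case True
      then have "x \<in> S" using regular_point_interior[OF visc assms(5) True] x(3) by (auto simp: S_def)
      then show ?thesis using K \<epsilon>(2) x by blast
    qed
  qed
  then have "{t. singular_time \<Omega>0 u t} \<subseteq> insert 0 (u ` K)" by blast
  then show ?thesis using K(2) finite_subset by blast
qed

end
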